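(* Let $x:[0,1]\to\mathbb{R}$ be the horizontal component of the Peano curve and let $L$ be its local time with respect to the Lebesgue measure. Define $\varphi:(0,1)\to[0,+\infty)$ by $$\varphi(c)=\frac{1}{3^{\lfloor-\log_3c\rfloor}\left(1-\frac34\,3^{\lfloor-\log_3c\rfloor}\,c\right)} .$$ Then $\lim_{c\to0+}\varphi(c)=0$, and for every $t\in[0,1]$ and every continuous $g:\mathbb{R}\to\mathbb{R}$ $$\lim_{c\to0+}\int_{\mathbb{R}}\varphi(c)\,\mathrm{n}^{z,c}(x,[0,t])\,g(z)\,dz=\int_{\mathbb{R}}L_t^z\,g(z)\,dz .$$
   Context: Horizontal component of the Peano curve: for $t\in[0,1]$ write a ternary expansion $t=\sum_{j\ge1}t_j3^{-j}$ with $t_j\in\{0,1,2\}$ (for $t=1$ all $t_j=2$). Let $\kappa:\{0,1,2\}\to\{0,1,2\}$, $\kappa(d)=2-d$, and let $\kappa^{v}$ be its $v$-th iterate ($\kappa^0=\mathrm{id}$). Then $$x(t)=\sum_{j\ge1}3^{-j}\,\kappa^{\,t_2+t_4+\dots+t_{2j-2}}(t_{2j-1}),$$ where for $j=1$ the exponent of $\kappa$ is $0$. The value does not depend on the choice of ternary expansion of $t$, and $x$ is a continuous function from $[0,1]$ onto $[0,1]$. Local time: a local time of $x$ with respect to the Lebesgue measure is a function $L:[0,1]\times\mathbb{R}\to[0,+\infty)$, $(t,z)\mapsto L_t^z$, such that for every $t\in[0,1]$ the function $z\mapsto L_t^z$ is Borel measurable and for every bounded Borel-measurable $g:\mathbb{R}\to\mathbb{R}$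 one has $\int_0^tg(x(s))\,ds=\int_{\mathbb{R}}g(z)L_t^z\,dz$. Such an $L$ exists for this $x$ (and for each $t$ it is unique up to Lebesgue-null sets of $z$). Numbers of crossings: for a continuous $f:[0,1]\to\mathbb{R}$, an interval $[s,t]\subseteq[0,1]$, $z\in\mathbb{R}$ and $c>0$, define $\sigma_0^c=s$ and for $n=0,1,2,\dots$ $$\tau_n^c=\inf\{u\in[\sigma_n^c,t]:f(u)\ge z+c/2\},\qquad \sigma_{n+1}^c=\inf\{u\in[\tau_n^c,t]:f(u)<z-c/2\},$$ with the conventions $\inf\emptyset=+\infty$ and $[+\infty,t]=\emptyset$. The number of downcrossings is $\mathrm{d}^{z,c}(f,[s,t])=\max\{n:\sigma_n^c\le t\}$, the number of upcrossings is $\mathrm{u}^{z,c}(f,[s,t])=\mathrm{d}^{-z,c}(-f,[s,t])$, and the number of crossings of the interval $[z-c/2,z+c/2]$ by $f$ on $[s,t]$ is $\mathrm{n}^{z,c}(f,[s,t])=\mathrm{u}^{z,c}(f,[s,t])+\mathrm{d}^{z,c}(f,[s,t])$. $\lfloor\cdot\rfloor$ denotes the floor function. *)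

theory Defs
  imports "HOL-Analysis.Analysis"
begin

text \<open>Digit sequences are indexed from 1; the value at index 0 is ignored.\<close>

definition ternary_expansion :: "(nat \<Rightarrow> nat) \<Rightarrow> real \<Rightarrow> bool" where
  "ternary_expansion d t \<longleftrightarrow>
     (\<forall>j\<ge>1. d j \<in> {0, 1, 2}) \<and> (\<lambda>j. real (d (Suc j)) / 3 ^ Suc j) sums t"

definition kappa :: "nat \<Rightarrow> nat" where
  "kappa d = 2 - d"

text \<open>The summation index \<open>j\<close> below is the usual one minus 1.\<close>

definition peano_series :: "(nat \<Rightarrow> nat) \<Rightarrow> real" where
  "peano_series d =
     (\<Sum>j. real ((kappa ^^ (\<Sum>i=1..j. d (2 * i))) (d (2 * j + 1))) / 3 ^ Suc j)"

text \<open>The value does not depend on which expansion of \<open>t\<close> is chosen.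
  Only arguments in \<open>[0,1]\<close> are meaningful.\<close>

definition peano_x :: "real \<Rightarrow> real" where
  "peano_x t = peano_series (SOME d. ternary_expansion d t)"

text \<open>The identity between the two integrals includes their existence; it is stated
  explicitly because the Bochner integral of a non-integrable function is 0.
  Only the values \<open>L t z\<close> with \<open>t \<in> {0..1}\<close> are constrained.\<close>

definition is_local_time :: "(real \<Rightarrow> real) \<Rightarrow> (real \<Rightarrow> real \<Rightarrow> real) \<Rightarrow> bool" where
  "is_local_time f L \<longleftrightarrow>
     (\<forall>t\<in>{0..1}.
        (\<forall>z. 0 \<le> L t z) \<and>
        L t \<in> borel_measurable borel \<and>
        (\<forall>g::real \<Rightarrow> real. g \<in> borel_measurable borel \<and> bounded (range g) \<longrightarrow>
           set_integrable lborel {0..t} (\<lambda>s. g (f s)) \<and>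
           integrable lborel (\<lambda>z. g z * L t z) \<and>
           (LINT s:{0..t}|lborel. g (f s)) = (LINT z|lborel. g z * L t z)))"

text \<open>Times take values in \<open>ereal\<close>, where the infimum of the empty set is \<open>\<infinity>\<close> and
  no real \<open>u\<close> satisfies \<open>\<infinity> \<le> ereal u\<close>. The argument \<open>a\<close> is the preceding time.\<close>

definition hit_above :: "(real \<Rightarrow> real) \<Rightarrow> real \<Rightarrow> real \<Rightarrow> real \<Rightarrow> ereal \<Rightarrow> ereal" where
  "hit_above f t z c a = Inf (ereal ` {u. a \<le> ereal u \<and> u \<le> t \<and> f u \<ge> z + c / 2})"

definition hit_below :: "(real \<Rightarrow> real) \<Rightarrow> real \<Rightarrow> real \<Rightarrow> real \<Rightarrow> ereal \<Rightarrow> ereal" where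
  "hit_below f t z c a = Inf (ereal ` {u. a \<le> ereal u \<and> u \<le> t \<and> f u < z - c / 2})"

primrec cross_sigma :: "(real \<Rightarrow> real) \<Rightarrow> real \<Rightarrow> real \<Rightarrow> real \<Rightarrow> real \<Rightarrow> nat \<Rightarrow> ereal" where
  "cross_sigma f s t z c 0 = ereal s"
| "cross_sigma f s t z c (Suc n) =
     hit_below f t z c (hit_above f t z c (cross_sigma f s t z c n))"

definition downcrossings :: "real \<Rightarrow> real \<Rightarrow> (real \<Rightarrow> real) \<Rightarrow> real \<Rightarrow> real \<Rightarrow> nat" where
  "downcrossings z c f s t = Max {n. cross_sigma f s t z c n \<le> ereal t}"

definition upcrossings :: "real \<Rightarrow> real \<Rightarrow> (real \<Rightarrow> real) \<Rightarrow> real \<Rightarrow> real \<Rightarrow> nat" where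
  "upcrossings z c f s t = downcrossings (- z) c (\<lambda>u. - f u) s t"

definition crossings :: "real \<Rightarrow> real \<Rightarrow> (real \<Rightarrow> real) \<Rightarrow> real \<Rightarrow> real \<Rightarrow> nat" where
  "crossings z c f s t = upcrossings z c f s t + downcrossings z c f s t"

definition peano_phi :: "real \<Rightarrow> real" where
  "peano_phi c =
     1 / (3 powi \<lfloor>- log 3 c\<rfloor> * (1 - 3 / 4 * 3 powi \<lfloor>- log 3 c\<rfloor> * c))"

end

theory Submission
  imports Defs
begin

text \<open>On each ninth of the time interval \<open>x\<close> is a copy of \<open>x\<close> or \<open>1 - x\<close>, scaled by \<open>1/3\<close>, inside a
  column \<open>[k/3, (k+1)/3]\<close>. Let \<open>N c\<close> be the integral over \<open>z\<close> of the number of crossings by \<open>x\<close> on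
  \<open>[0,1]\<close> of the interval of length \<open>c\<close> around \<open>z\<close>. For \<open>c \<le> 1/3\<close> such an interval with \<open>1/3\<close> or \<open>2/3\<close>
  in its interior is crossed exactly once, because \<open>x \<le> k/3\<close> before and \<open>x \<ge> k/3\<close> after time \<open>k/3\<close>; for
  almost all other \<open>z\<close> the crossings on the nine pieces add up. Hence \<open>N c = 3 * N (3 * c) + 2 * c\<close>.
  For \<open>1/3 < c \<le> 1\<close> one has \<open>N c = 1 - c\<close>, because \<open>x\<close> never falls by more than \<open>1/3\<close>. Solving the
  recursion gives \<open>\<phi> c * N c = 1 + O(c^2)\<close>.

  By scaling, the crossings on a time cell of length \<open>9^-m\<close> have \<open>\<phi> c\<close>-weighted mass close to \<open>9^-m\<close>,
  carried by a column of width \<open>3^-m\<close> on which \<open>g\<close> is almost constant. Splitting \<open>[0,t]\<close> into such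
  cells loses at most two crossings per cell boundary, which is negligible as \<open>c\<close> tends to 0. So the
  weighted integrals converge to the integral of \<open>g (x s)\<close> over \<open>[0,t]\<close>, which the local time
  rewrites as the integral of \<open>L t z * g z\<close>.\<close>

section \<open>Self-similarity of the horizontal Peano component\<close>

text \<open>\<open>kappa\<close> is an involution on the digits 0, 1, 2, so only the parity of the
  exponent matters.\<close>

lemma kappa_funpow:
  assumes "d \<le> 2"
  shows "(kappa ^^ k) d = (if even k then d else 2 - d)"
  using assms by (induction k) (auto simp: kappa_def)

abbreviation shift2 :: "(nat \<Rightarrow> nat) \<Rightarrow> nat \<Rightarrow> nat" where
  "shift2 d \<equiv> \<lambda>j. d (j + 2)"

definition ternary_digits :: "(nat \<Rightarrow> nat) \<Rightarrow> bool" where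
  "ternary_digits d \<longleftrightarrow> (\<forall>j\<ge>1. d j \<le> 2)"

definition peano_term :: "(nat \<Rightarrow> nat) \<Rightarrow> nat \<Rightarrow> real" where
  "peano_term d j =
     real ((kappa ^^ (\<Sum>i=1..j. d (2 * i))) (d (2 * j + 1))) / 3 ^ Suc j"

text \<open>The series with all digits 2 is the summable majorant of every digit series. Subtracting
  a digit series from it complements all digits and turns the value \<open>v\<close> into
  \<open>1 - v\<close>.\<close>

lemma sums_two_thirds: "(\<lambda>j. 2 / 3 ^ Suc j :: real) sums 1"
proof -
  have "(\<lambda>j. (2/3) * (1/3) ^ j :: real) sums ((2/3) * (1 / (1 - 1/3)))"
    by (intro sums_mult geometric_sums) auto
  thus ?thesis by (simp add: power_divide field_simps)
qed

lemma peano_term_bounds: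
  assumes "ternary_digits d"
  shows "0 \<le> peano_term d j" "peano_term d j \<le> 2 / 3 ^ Suc j"
  using assms by (auto simp: peano_term_def kappa_funpow ternary_digits_def divide_simps)

lemma peano_series_sums:
  assumes "ternary_digits d"
  shows "peano_term d sums peano_series d"
proof -
  have "summable (peano_term d)"
    using sums_two_thirds[THEN sums_summable] peano_term_bounds[OF assms]
    by (rule_tac summable_comparison_test') auto
  thus ?thesis
    unfolding peano_series_def peano_term_def by (rule summable_sums)
qed

lemma peano_series_bounds:
  assumes "ternary_digits d"
  shows "peano_series d \<in> {0..1}"
  using sums_le[OF _ sums_zero peano_series_sums[OF assms]]
    sums_le[OF _ peano_series_sums[OF assms] sums_two_thirds]
    peano_term_bounds[OF assms] by auto

text \<open>Dropping two digits removes \<open>d 2\<close> from every later exponent. For odd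
  \<open>d 2\<close> this complements each later output digit, hence reflects the value of the tail.
  The input loses two ternary places but the output only one, so the tail is scaled by
  \<open>1 / 3\<close>.\<close>

lemma peano_series_shift2:
  assumes "ternary_digits d"
  shows "peano_series d =
    (real (d 1) + (if even (d 2) then peano_series (shift2 d) else 1 - peano_series (shift2 d))) / 3"
proof -
  have d': "ternary_digits (shift2 d)"
    using assms by (auto simp: ternary_digits_def)
  have *: "(\<Sum>i=1..Suc j. d (2 * i)) = d 2 + (\<Sum>i=1..j. shift2 d (2 * i))" for j
    by (subst sum.atLeast_Suc_atMost)
      (auto simp: sum.shift_bounds_cl_Suc_ivl simp del: sum.cl_ivl_Suc)
  have dig: "d (Suc (Suc (Suc (2 * j)))) \<le> 2" for j
    using assms by (auto simp: ternary_digits_def)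
  have step: "peano_term d (Suc j) =
      (if even (d 2) then peano_term (shift2 d) j else 2 / 3 ^ Suc j - peano_term (shift2 d) j) / 3" for j
  proof -
    let ?S = "\<Sum>i=1..j. shift2 d (2 * i)" and ?x = "d (Suc (Suc (Suc (2 * j))))"
    have "real ((kappa ^^ (d 2 + ?S)) ?x) =
        (if even (d 2) then real ((kappa ^^ ?S) ?x) else 2 - real ((kappa ^^ ?S) ?x))"
      using dig[of j] by (simp add: kappa_funpow of_nat_diff)
    thus ?thesis unfolding peano_term_def * by (simp add: diff_divide_distrib)
  qed
  have "(\<lambda>j. peano_term d (Suc j)) sums
      ((if even (d 2) then peano_series (shift2 d) else 1 - peano_series (shift2 d)) / 3)"
    unfolding step
    using peano_series_sums[OF d'] sums_diff[OF sums_two_thirds peano_series_sums[OF d']]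
    by (cases "even (d 2)") (auto intro: sums_divide)
  hence "peano_term d sums
      ((if even (d 2) then peano_series (shift2 d) else 1 - peano_series (shift2 d)) / 3 + peano_term d 0)"
    unfolding sums_Suc_iff .
  from sums_unique2[OF peano_series_sums[OF assms] this] show ?thesis
    by (simp add: peano_term_def add_divide_distrib)
qed

section \<open>Ternary expansions: existence and independence of the choice\<close>

lemma ternary_expansion_digits:
  "ternary_expansion d t \<Longrightarrow> ternary_digits d"
  unfolding ternary_expansion_def ternary_digits_def by fastforce

lemma ternary_expansion_bounds:
  assumes "ternary_expansion d t"
  shows "t \<in> {0..1}"
proof -
  have "real (d (Suc j)) / 3 ^ Suc j \<le> 2 / 3 ^ Suc j" for j
    using ternary_expansion_digits[OF assms] by (auto simp: ternary_digits_def divide_simps)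
  thus ?thesis
    using assms sums_le[OF _ sums_zero, of "\<lambda>j. real (d (Suc j)) / 3 ^ Suc j" t]
      sums_le[OF _ _ sums_two_thirds, of "\<lambda>j. real (d (Suc j)) / 3 ^ Suc j" t]
    by (auto simp: ternary_expansion_def)
qed

text \<open>The number \<open>9 * t - 3 * d 1 - d 2\<close> is the rescaled position of
  \<open>t\<close> in the ninth selected by the first two digits. The equivalence is used both to
  strip leading digits and to prepend them.\<close>

lemma ternary_expansion_shift2:
  "ternary_expansion d t \<longleftrightarrow>
     d 1 \<le> 2 \<and> d 2 \<le> 2 \<and> ternary_expansion (shift2 d) (9 * t - 3 * real (d 1) - real (d 2))"
proof -
  let ?f = "\<lambda>j. real (d (Suc j)) / 3 ^ Suc j"
  have "?f sums t \<longleftrightarrow> (\<lambda>j. ?f (j + 2)) sums (t - (\<Sum>j<2. ?f j))"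
    by (rule sums_iff_shift'[symmetric])
  also have "\<dots> \<longleftrightarrow> (\<lambda>j. 9 * ?f (j + 2)) sums (9 * (t - (\<Sum>j<2. ?f j)))"
    by (subst sums_mult_iff) auto
  also have "(\<lambda>j. 9 * ?f (j + 2)) = (\<lambda>j. real (shift2 d (Suc j)) / 3 ^ Suc j)"
    by (auto simp: field_simps)
  also have "9 * (t - (\<Sum>j<2. ?f j)) = 9 * t - 3 * real (d 1) - real (d 2)"
    by (simp add: numeral_2_eq_2 field_simps)
  finally have 1: "?f sums t \<longleftrightarrow>
    (\<lambda>j. real (shift2 d (Suc j)) / 3 ^ Suc j) sums (9 * t - 3 * real (d 1) - real (d 2))" .
  have split: "(\<forall>j\<ge>1. R j) \<longleftrightarrow> R 1 \<and> R 2 \<and> (\<forall>j\<ge>1. R (j + 2))" for R :: "nat \<Rightarrow> bool"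
  proof
    assume *: "R 1 \<and> R 2 \<and> (\<forall>j\<ge>1. R (j + 2))"
    show "\<forall>j\<ge>1. R j"
    proof (intro allI impI)
      fix j :: nat assume "1 \<le> j"
      hence "j = 1 \<or> j = 2 \<or> (\<exists>k\<ge>1. j = k + 2)" by presburger
      thus "R j" using * by auto
    qed
  qed auto
  have 2: "(\<forall>j\<ge>1. d j \<in> {0,1,2}) \<longleftrightarrow> d 1 \<le> 2 \<and> d 2 \<le> 2 \<and> (\<forall>j\<ge>1. shift2 d j \<in> {0,1,2})"
    by (subst split) auto
  show ?thesis unfolding ternary_expansion_def 1 2 by blast
qed

text \<open>The tail again expands a number in [0,1], which forces both leading digits to be 0. Each
  shift therefore divides the bound by 3, starting from the trivial bound 1.\<close>

lemma peano_series_of_zero: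
  assumes "ternary_expansion d 0"
  shows "peano_series d = 0"
proof -
  have "\<bar>peano_series d\<bar> \<le> (1/3) ^ n" for n
    using assms
  proof (induction n arbitrary: d)
    case 0
    thus ?case using peano_series_bounds[OF ternary_expansion_digits] by fastforce
  next
    case (Suc n)
    have s: "ternary_expansion (shift2 d) (- 3 * real (d 1) - real (d 2))"
      using Suc.prems ternary_expansion_shift2[of d 0] by auto
    hence "d 1 = 0" "d 2 = 0" using ternary_expansion_bounds[OF s] by auto
    thus ?case
      using s Suc.IH[of "shift2 d"] peano_series_shift2[OF ternary_expansion_digits[OF Suc.prems]] by auto
  qed
  moreover have "(\<lambda>n. (1/3) ^ n :: real) \<longlonglongrightarrow> 0" by (rule LIMSEQ_power_zero) auto
  ultimately have "\<bar>peano_series d\<bar> \<le> 0" by (intro LIMSEQ_le_const) auto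
  thus ?thesis by simp
qed

text \<open>As for 0, but now both leading digits are forced to be 2; the even second digit keeps
  the orientation of the tail.\<close>

lemma peano_series_of_one:
  assumes "ternary_expansion d 1"
  shows "peano_series d = 1"
proof -
  have "\<bar>peano_series d - 1\<bar> \<le> (1/3) ^ n" for n
    using assms
  proof (induction n arbitrary: d)
    case 0
    thus ?case using peano_series_bounds[OF ternary_expansion_digits] by fastforce
  next
    case (Suc n)
    have s: "ternary_expansion (shift2 d) (9 - 3 * real (d 1) - real (d 2))" "d 1 \<le> 2" "d 2 \<le> 2"
      using Suc.prems ternary_expansion_shift2[of d 1] by auto
    hence "d 1 = 2" "d 2 = 2" using ternary_expansion_bounds[OF s(1)] by auto
    hence eq: "peano_series d - 1 = (peano_series (shift2 d) - 1) / 3"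
      using peano_series_shift2[OF ternary_expansion_digits[OF Suc.prems]] by simp
    have "\<bar>peano_series (shift2 d) - 1\<bar> \<le> (1/3) ^ n"
      using s \<open>d 1 = 2\<close> \<open>d 2 = 2\<close> by (intro Suc.IH) simp
    thus ?case unfolding eq by (simp add: abs_divide)
  qed
  moreover have "(\<lambda>n. (1/3) ^ n :: real) \<longlonglongrightarrow> 0" by (rule LIMSEQ_power_zero) auto
  ultimately have "\<bar>peano_series d - 1\<bar> \<le> 0" by (intro LIMSEQ_le_const) auto
  thus ?thesis by simp
qed

text \<open>Different leading pairs mean that \<open>t\<close> is the common endpoint of two
  adjacent ninths, so the tail of \<open>d\<close> expands 1 and the tail of \<open>e\<close>
  expands 0. The alternating orientation of the ninths makes the two values agree, also when the
  second digit carries over.\<close>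

lemma peano_series_ambiguous:
  assumes d: "ternary_expansion d t" and e: "ternary_expansion e t"
    and less: "3 * d 1 + d 2 < 3 * e 1 + e 2"
  shows "peano_series d = peano_series e"
proof -
  have sd: "d 1 \<le> 2" "d 2 \<le> 2" "ternary_expansion (shift2 d) (9 * t - 3 * real (d 1) - real (d 2))"
    and se: "e 1 \<le> 2" "e 2 \<le> 2" "ternary_expansion (shift2 e) (9 * t - 3 * real (e 1) - real (e 2))"
    using d e ternary_expansion_shift2[of d t] ternary_expansion_shift2[of e t] by auto
  have "real (3 * d 1 + d 2 + 1) \<le> real (3 * e 1 + e 2)"
    using less by (intro of_nat_mono) auto
  \<comment> \<open>Both tails expand numbers in [0,1] that differ by at least 1, so the
    inequalities are equalities.\<close>
  hence *: "9 * t - 3 * real (d 1) - real (d 2) = 1" "9 * t - 3 * real (e 1) - real (e 2) = 0"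
    "3 * real (d 1) + real (d 2) + 1 = 3 * real (e 1) + real (e 2)"
    using ternary_expansion_bounds[OF sd(3)] ternary_expansion_bounds[OF se(3)] by auto
  have "3 * d 1 + d 2 + 1 = 3 * e 1 + e 2"
    using *(3) by linarith
  hence "d 2 = 0 \<and> e 2 = 1 \<and> e 1 = d 1 \<or> d 2 = 1 \<and> e 2 = 2 \<and> e 1 = d 1 \<or> d 2 = 2 \<and> e 2 = 0 \<and> e 1 = Suc (d 1)"
    using sd se by presburger
  moreover have "peano_series d = (real (d 1) + (if even (d 2) then 1 else 0)) / 3"
    using peano_series_shift2[OF ternary_expansion_digits[OF d]]
      peano_series_of_one[OF sd(3)[unfolded *(1)]] by simp
  moreover have "peano_series e = (real (e 1) + (if even (e 2) then 0 else 1)) / 3"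
    using peano_series_shift2[OF ternary_expansion_digits[OF e]]
      peano_series_of_zero[OF se(3)[unfolded *(2)]] by simp
  ultimately show ?thesis by (elim disjE conjE) simp_all
qed

text \<open>Equal leading pairs reduce the difference to a third of the difference of the tails;
  unequal pairs give equal values at once. Iterating pushes the difference below every power of
  \<open>1 / 3\<close>.\<close>

lemma peano_series_unique:
  assumes "ternary_expansion d t" "ternary_expansion e t"
  shows "peano_series d = peano_series e"
proof -
  have "\<bar>peano_series d - peano_series e\<bar> \<le> (1/3) ^ n" for n
    using assms
  proof (induction n arbitrary: d e t)
    case 0
    have "peano_series d \<in> {0..1}" "peano_series e \<in> {0..1}"
      using 0 by (blast intro: peano_series_bounds ternary_expansion_digits)+
    thus ?case by auto
  next
    case (Suc n)
    note d = Suc.prems(1) and e = Suc.prems(2)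
    consider "3 * d 1 + d 2 < 3 * e 1 + e 2" | "3 * e 1 + e 2 < 3 * d 1 + d 2"
      | "3 * d 1 + d 2 = 3 * e 1 + e 2" by linarith
    thus ?case
    proof cases
      case 3
      have sd: "d 1 \<le> 2" "d 2 \<le> 2" "ternary_expansion (shift2 d) (9 * t - 3 * real (d 1) - real (d 2))"
        and se: "e 1 \<le> 2" "e 2 \<le> 2" "ternary_expansion (shift2 e) (9 * t - 3 * real (e 1) - real (e 2))"
        using d e ternary_expansion_shift2[of d t] ternary_expansion_shift2[of e t] by auto
      have eq: "e 1 = d 1" "e 2 = d 2" using 3 sd se by presburger+
      have "\<bar>peano_series d - peano_series e\<bar> = \<bar>peano_series (shift2 d) - peano_series (shift2 e)\<bar> / 3"
        unfolding peano_series_shift2[OF ternary_expansion_digits[OF d]]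
          peano_series_shift2[OF ternary_expansion_digits[OF e]] eq
        by (cases "even (d 2)") (simp_all add: diff_divide_distrib[symmetric] abs_divide abs_minus_commute)
      thus ?thesis using Suc.IH[OF sd(3) se(3)[unfolded eq]] by simp
    qed (use peano_series_ambiguous[OF d e] peano_series_ambiguous[OF e d] in auto)
  qed
  moreover have "(\<lambda>n. (1/3) ^ n :: real) \<longlonglongrightarrow> 0" by (rule LIMSEQ_power_zero) auto
  ultimately have "\<bar>peano_series d - peano_series e\<bar> \<le> 0" by (intro LIMSEQ_le_const) auto
  thus ?thesis by simp
qed

lemma ternary_expansion_exists:
  assumes "t \<in> {0..1}"
  shows "\<exists>d. ternary_expansion d t"
proof (cases "t = 1")
  case True
  thus ?thesis using sums_two_thirds by (intro exI[of _ "\<lambda>_. 2"]) (auto simp: ternary_expansion_def)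
next
  case False
  \<comment> \<open>These digits rebuild \<open>t\<close> from its integer part, which must be 0.
    This is why \<open>t = 1\<close> was given the digits 2 separately.\<close>
  define d where "d j = nat (\<lfloor>3 ^ j * t\<rfloor> mod 3)" for j
  have d: "real (d j) = real_of_int (\<lfloor>3 ^ j * t\<rfloor> mod 3)" for j
    by (simp add: d_def)
  have step: "real_of_int \<lfloor>3 ^ Suc j * t\<rfloor> = 3 * real_of_int \<lfloor>3 ^ j * t\<rfloor> + real (d (Suc j))" for j
  proof -
    have "\<lfloor>3 ^ j * t\<rfloor> = \<lfloor>3 ^ Suc j * t\<rfloor> div 3"
      using floor_divide_real_eq_div[of 3 "3 ^ Suc j * t"] by simp
    hence "\<lfloor>3 ^ Suc j * t\<rfloor> = 3 * \<lfloor>3 ^ j * t\<rfloor> + \<lfloor>3 ^ Suc j * t\<rfloor> mod 3" by simp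
    thus ?thesis unfolding d by (metis of_int_add of_int_mult of_int_numeral)
  qed
  have "\<lfloor>t\<rfloor> = 0" using assms False by (simp add: floor_eq_iff)
  hence part: "(\<Sum>j<n. real (d (Suc j)) / 3 ^ Suc j) = real_of_int \<lfloor>3 ^ n * t\<rfloor> / 3 ^ n" for n
      proof (induction n)
    case (Suc n)
    thus ?case using step[of n] by (simp add: add_divide_distrib)
  qed simp
  have "\<bar>real_of_int \<lfloor>3 ^ n * t\<rfloor> / 3 ^ n - t\<bar> \<le> (1/3) ^ n" for n
  proof -
    have "real_of_int \<lfloor>3 ^ n * t\<rfloor> / 3 ^ n - t = (real_of_int \<lfloor>3 ^ n * t\<rfloor> - 3 ^ n * t) / 3 ^ n"
      by (simp add: field_simps)
    also have "\<bar>\<dots>\<bar> \<le> 1 / 3 ^ n"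
      unfolding abs_divide by (intro divide_mono) (auto simp: abs_le_iff, linarith+)
    finally show ?thesis by (simp add: power_divide)
  qed
  hence "(\<lambda>n. real_of_int \<lfloor>3 ^ n * t\<rfloor> / 3 ^ n - t) \<longlonglongrightarrow> 0"
    by (intro Lim_null_comparison[OF always_eventually LIMSEQ_power_zero[of "1/3 :: real"]]) auto
  hence "(\<lambda>j. real (d (Suc j)) / 3 ^ Suc j) sums t"
    unfolding sums_def part by (rule LIM_zero_cancel)
  moreover have "d j \<in> {0,1,2}" for j
  proof -
    have "\<lfloor>3 ^ j * t\<rfloor> mod 3 \<in> {0,1,2}" by auto
    thus ?thesis by (auto simp: d_def)
  qed
  ultimately show ?thesis unfolding ternary_expansion_def by blast
qed

section \<open>The function \<open>peano_x\<close> and its self-similarity on ninths\<close>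

lemma peano_x_eq: "ternary_expansion d t \<Longrightarrow> peano_x t = peano_series d"
  unfolding peano_x_def by (metis peano_series_unique someI_ex)

lemma peano_x_bounds:
  assumes "t \<in> {0..1}"
  shows "peano_x t \<in> {0..1}"
  using ternary_expansion_exists[OF assms] peano_x_eq peano_series_bounds ternary_expansion_digits
  by metis

lemma peano_x_0: "peano_x 0 = 0"
  using ternary_expansion_exists[of 0] peano_x_eq peano_series_of_zero by force

lemma peano_x_1: "peano_x 1 = 1"
  using ternary_expansion_exists[of 1] peano_x_eq peano_series_of_one by force

text \<open>Prepending the digits \<open>i\<close> and \<open>j\<close> to an expansion of
  \<open>s\<close> expands the time on the left-hand side, and \<open>peano_series_shift2\<close>
  evaluates the result.\<close>

lemma peano_x_ninth:
  assumes s: "s \<in> {0..1}" and "i \<le> 2" "j \<le> 2"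
  shows "peano_x ((3 * real i + real j + s) / 9) =
    (real i + (if even j then peano_x s else 1 - peano_x s)) / 3"
proof -
  obtain e where e: "ternary_expansion e s" using ternary_expansion_exists[OF s] by blast
  define d where "d k = (if k = 1 then i else if k = 2 then j else e (k - 2))" for k
  have e': "ternary_expansion (shift2 d) s"
    using e by (auto simp: d_def ternary_expansion_def)
  hence d: "ternary_expansion d ((3 * real i + real j + s) / 9)"
  proof (subst ternary_expansion_shift2, intro conjI)
    have "9 * ((3 * real i + real j + s) / 9) - 3 * real (d 1) - real (d 2) = s"
      by (simp add: d_def add_divide_distrib)
    thus "ternary_expansion (shift2 d)
        (9 * ((3 * real i + real j + s) / 9) - 3 * real (d 1) - real (d 2))"
      using e' by (simp only:)
  qed (use assms in \<open>auto simp: d_def\<close>)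
  show ?thesis
    using peano_x_eq[OF d] peano_x_eq[OF e'] peano_series_shift2[OF ternary_expansion_digits[OF d]]
    by (simp add: d_def)
qed

section \<open>Crossing numbers of continuous functions\<close>

text \<open>With \<open>P\<close> for being above and \<open>Q\<close> for being below, this
  describes \<open>n\<close> downcrossings completed at time \<open>v\<close> by the mere existence
  of times. Unlike nested infima, such chains are easily concatenated, cut and
  reparametrised.\<close>

primrec alternates :: "(real \<Rightarrow> bool) \<Rightarrow> (real \<Rightarrow> bool) \<Rightarrow> nat \<Rightarrow> real \<Rightarrow> real \<Rightarrow> bool" where
  "alternates P Q 0 s v \<longleftrightarrow> s \<le> v"
| "alternates P Q (Suc n) s v \<longleftrightarrow> (\<exists>w u. alternates P Q n s w \<and> w \<le> u \<and> u \<le> v \<and> P u \<and> Q v)"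

lemma alternates_ge: "alternates P Q n s v \<Longrightarrow> s \<le> v"
  by (induction n arbitrary: v) (simp, force)

lemma alternates_mono:
  "alternates P Q n s v \<Longrightarrow> k \<le> n \<Longrightarrow> \<exists>v'\<le>v. alternates P Q k s v'"
proof (induction n arbitrary: v)
  case (Suc n)
  show ?case
  proof (cases "k = Suc n")
    case False
    then obtain w u where "alternates P Q n s w" "w \<le> u" "u \<le> v" "k \<le> n" using Suc.prems by auto
    thus ?thesis using Suc.IH[of w] by (meson order_trans)
  qed (use Suc.prems in blast)
qed auto

lemma alternates_cong:
  assumes "\<And>u. s \<le> u \<Longrightarrow> u \<le> t \<Longrightarrow> P u = P' u \<and> Q u = Q' u" "v \<le> t"
  shows "alternates P Q n s v = alternates P' Q' n s v"
  using assms(2)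
proof (induction n arbitrary: v)
  case (Suc n)
  have "alternates P Q n s w \<and> w \<le> u \<and> u \<le> v \<and> P u \<and> Q v \<longleftrightarrow>
      alternates P' Q' n s w \<and> w \<le> u \<and> u \<le> v \<and> P' u \<and> Q' v" for w u
  proof (cases "w \<le> u \<and> u \<le> v \<and> s \<le> w")
    case True
    thus ?thesis using assms(1)[of u] assms(1)[of v] Suc by auto
  next
    case False
    thus ?thesis using alternates_ge by blast
  qed
  thus ?case by simp
qed simp

lemma alternates_affine:
  assumes "(\<gamma>::real) > 0"
  shows "alternates P Q n (\<alpha> + \<gamma> * s) (\<alpha> + \<gamma> * v) =
    alternates (\<lambda>u. P (\<alpha> + \<gamma> * u)) (\<lambda>u. Q (\<alpha> + \<gamma> * u)) n s v"
proof (induction n arbitrary: v)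
  case (Suc n)
  have ex: "(\<exists>w. R w) \<longleftrightarrow> (\<exists>w. R (\<alpha> + \<gamma> * w))" for R
  proof
    assume "\<exists>w. R w"
    then obtain w where "R w" ..
    hence "R (\<alpha> + \<gamma> * ((w - \<alpha>) / \<gamma>))" using assms by simp
    thus "\<exists>w. R (\<alpha> + \<gamma> * w)" ..
  qed blast
  show ?case
    unfolding alternates.simps
    by (subst ex, rule ex_cong1, subst ex, rule ex_cong1) (use assms Suc in simp)
qed (use assms in auto)

text \<open>The second chain starts no earlier than the first one ends. When \<open>k = 0\<close>
  the joint chain ends at \<open>w\<close> already, which is why only some \<open>v'\<close> below
  \<open>v\<close> is claimed.\<close>

lemma alternates_append:
  assumes "alternates P Q i s w" "w \<le> m" "alternates P Q k m v"
  shows "\<exists>v'\<le>v. alternates P Q (i + k) s v'"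
  using assms(3)
proof (induction k arbitrary: v)
  case 0
  thus ?case using assms(1,2) by (intro exI[of _ w]) auto
next
  case (Suc k)
  then obtain w2 u where *: "alternates P Q k m w2" "w2 \<le> u" "u \<le> v" "P u" "Q v" by auto
  then obtain v' where "v' \<le> w2" "alternates P Q (i + k) s v'" using Suc.IH by blast
    hence "alternates P Q (Suc (i + k)) s v"
      unfolding alternates.simps using * by (intro exI[of _ v'] exI[of _ u]) auto
    hence "alternates P Q (i + Suc k) s v" by simp
  thus ?case by blast
qed

text \<open>Only a pair with its \<open>P\<close> time before \<open>m\<close> and its
  \<open>Q\<close> time after \<open>m\<close> can be lost. If \<open>m\<close> satisfies
  \<open>Q\<close>, it closes this pair early; if it satisfies \<open>P\<close>, it opens the pair
  late.\<close>

lemma alternates_split: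
  assumes "alternates P Q n s v" "s \<le> m" "m \<le> v"
  shows "\<exists>i k w. alternates P Q i s w \<and> w \<le> m \<and> alternates P Q k m v \<and> n \<le> Suc (i + k)
    \<and> (P m \<or> Q m \<longrightarrow> n \<le> i + k)"
  using assms
proof (induction n arbitrary: v)
  case 0
  hence "alternates P Q 0 s s \<and> s \<le> m \<and> alternates P Q 0 m v" by simp
  thus ?case by blast
next
  case (Suc n)
  then obtain w u where *: "alternates P Q n s w" "w \<le> u" "u \<le> v" "P u" "Q v" by auto
  \<comment> \<open>If the chain before the last pair already passes \<open>m\<close>, the induction
    hypothesis cuts it there. Otherwise the place of \<open>u\<close> relative to \<open>m\<close>
    decides on which side the last pair is counted.\<close>
  consider "w > m" | "w \<le> m" "u \<ge> m" | "w \<le> m" "u < m" "P m" | "w \<le> m" "u < m" "Q m"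
    | "w \<le> m" "u < m" "\<not> P m \<and> \<not> Q m" by linarith
  thus ?case
  proof cases
    case 1
    then obtain i k w' where "alternates P Q i s w'" "w' \<le> m" "alternates P Q k m w" "n \<le> Suc (i + k)"
      "P m \<or> Q m \<longrightarrow> n \<le> i + k"
      using Suc.IH[of w] * Suc.prems by auto
    moreover from this have "alternates P Q (Suc k) m v" using * by auto
    ultimately show ?thesis by (metis add_Suc_right Suc_le_mono)
  next
    case 2
    hence "alternates P Q (Suc 0) m v" using * by auto
    thus ?thesis using * 2 by (intro exI[of _ n] exI[of _ "Suc 0"] exI[of _ w]) auto
  next
    case 3
    hence "alternates P Q (Suc 0) m v" using * Suc.prems by auto
    thus ?thesis using * 3 by (intro exI[of _ n] exI[of _ "Suc 0"] exI[of _ w]) auto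
  next
    case 4
    hence "alternates P Q (Suc n) s m"
      unfolding alternates.simps using * by (intro exI[of _ w] exI[of _ u]) auto
    thus ?thesis using Suc.prems
      by (intro exI[of _ "Suc n"] exI[of _ 0] exI[of _ m]) (simp del: alternates.simps(2))
  next
    case 5
    thus ?thesis using * Suc.prems by (intro exI[of _ n] exI[of _ 0] exI[of _ w]) auto
  qed
qed

section \<open>Downcrossing numbers as lengths of longest alternations\<close>

abbreviation down_alternates :: "real \<Rightarrow> real \<Rightarrow> (real \<Rightarrow> real) \<Rightarrow> nat \<Rightarrow> real \<Rightarrow> real \<Rightarrow> bool" where
  "down_alternates z c f \<equiv> alternates (\<lambda>u. f u \<ge> z + c / 2) (\<lambda>u. f u < z - c / 2)"

lemma Inf_ereal_less_iff:
  "Inf (ereal ` A) < ereal u \<longleftrightarrow> (\<exists>w\<in>A. w < u)"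
  by (auto simp: Inf_less_iff)

text \<open>A point at the infimum of \<open>A\<close> that is not above an element of \<open>A\<close> would be a limit of \<open>A\<close>
  at which \<open>f\<close> violates the non-strict inequality that holds on \<open>A\<close>.\<close>

lemma Inf_ereal_le_iff_ge:
  assumes "continuous_on {s..t} f" "A \<subseteq> {s..t}" "\<And>w. w \<in> A \<Longrightarrow> f w \<ge> (b::real)"
    "u \<in> {s..t}" "f u < b"
  shows "Inf (ereal ` A) \<le> ereal u \<longleftrightarrow> (\<exists>w\<in>A. w \<le> u)"
proof
  assume le: "Inf (ereal ` A) \<le> ereal u"
  show "\<exists>w\<in>A. w \<le> u"
  proof (rule ccontr)
    assume no: "\<not> (\<exists>w\<in>A. w \<le> u)"
    obtain e where e: "e > 0" "\<And>w. w \<in> {s..t} \<Longrightarrow> dist w u < e \<Longrightarrow> dist (f w) (f u) < b - f u"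
      using assms(1,4,5) unfolding continuous_on_iff by (meson diff_gt_0_iff_gt)
    have "Inf (ereal ` A) < ereal (u + e)" using le e(1) by (meson ereal_less_ereal_Ex le_less_trans less_add_same_cancel1 less_ereal.simps(1))
    then obtain w where w: "w \<in> A" "w < u + e" by (auto simp: Inf_ereal_less_iff)
    hence "w > u" using no by force
    hence "dist (f w) (f u) < b - f u" using w assms(2) by (intro e(2)) (auto simp: dist_real_def)
    thus False using assms(3)[OF w(1)] by (auto simp: dist_real_def)
  qed
next
  assume "\<exists>w\<in>A. w \<le> u"
  thus "Inf (ereal ` A) \<le> ereal u" by (meson Inf_lower2 ereal_less_eq(3) imageI)
qed

lemma Inf_ereal_le_iff_le:
  assumes "continuous_on {s..t} f" "A \<subseteq> {s..t}" "\<And>w. w \<in> A \<Longrightarrow> f w \<le> (b::real)"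
    "u \<in> {s..t}" "f u > b"
  shows "Inf (ereal ` A) \<le> ereal u \<longleftrightarrow> (\<exists>w\<in>A. w \<le> u)"
  using Inf_ereal_le_iff_ge[of s t "\<lambda>u. - f u" A "- b" u] assms
  by (auto intro: continuous_intros)

text \<open>The infima defining the times need not be attained. By continuity, however, an infimum
  of low points is still weakly low and an infimum of high points weakly high. As
  \<open>c > 0\<close> separates the two levels, no point of the opposite kind sits exactly at an
  unattained infimum.\<close>

lemma cross_sigma_eq_Inf:
  assumes f: "continuous_on {s..t} f" and "c > 0" and st: "s \<le> t"
  shows "cross_sigma f s t z c n = Inf (ereal ` {v. v \<le> t \<and> down_alternates z c f n s v})"
proof (induction n)
  case 0
  have "Inf (ereal ` {v. v \<le> t \<and> s \<le> v}) = ereal s"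
    using st by (intro antisym Inf_lower Inf_greatest) auto
  thus ?case by simp
next
  case (Suc n)
  let ?C = "{v. v \<le> t \<and> down_alternates z c f n s v}"
  let ?E = "{u. u \<le> t \<and> f u \<ge> z + c / 2 \<and> (\<exists>w\<in>?C. w \<le> u)}"
  have C: "?C \<subseteq> {s..t}" by (auto dest: alternates_ge)
  hence E: "?E \<subseteq> {s..t}" by (auto dest!: alternates_ge)
  \<comment> \<open>For \<open>n = 0\<close> the infimum is \<open>s\<close> and is attained. For
    larger \<open>n\<close> the set consists of low points, while \<open>u\<close> is high and thus
    cannot be an unattained infimum of it.\<close>
  have C_iff: "Inf (ereal ` ?C) \<le> ereal u \<longleftrightarrow> (\<exists>w\<in>?C. w \<le> u)" if u: "u \<le> t" "f u \<ge> z + c / 2" for u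
  proof (cases n)
    case 0
    have "Inf (ereal ` ?C) = ereal s"
      using st 0 by (intro antisym Inf_lower Inf_greatest) auto
    thus ?thesis using u 0 st by auto
  next
    case (Suc k)
    have "w \<in> ?C \<Longrightarrow> f w \<le> z - c / 2" for w using Suc by auto
    moreover have "s \<le> u \<or> \<not> (Inf (ereal ` ?C) \<le> ereal u)"
    proof -
      have "ereal s \<le> Inf (ereal ` ?C)" using C by (intro Inf_greatest) auto
      thus ?thesis using order_trans ereal_less_eq(3) by blast
    qed
    moreover have "f u > z - c / 2" using u \<open>c > 0\<close> by (simp add: field_simps)
    ultimately show ?thesis using Inf_ereal_le_iff_le[OF f C, of "z - c / 2" u] u C by force
  qed
  have "hit_above f t z c (Inf (ereal ` ?C)) = Inf (ereal ` ?E)"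
    unfolding hit_above_def using C_iff by (intro arg_cong[where f = Inf] image_cong) auto
  moreover have "{u. Inf (ereal ` ?E) \<le> ereal u \<and> u \<le> t \<and> f u < z - c / 2} =
    {v. v \<le> t \<and> down_alternates z c f (Suc n) s v}"
  proof -
    have "Inf (ereal ` ?E) \<le> ereal u \<longleftrightarrow> (\<exists>w\<in>?E. w \<le> u)" if u: "u \<le> t" "f u < z - c / 2" for u
    proof -
      have "s \<le> u \<or> \<not> (Inf (ereal ` ?E) \<le> ereal u)"
      proof -
        have "ereal s \<le> Inf (ereal ` ?E)" using E by (intro Inf_greatest) auto
        thus ?thesis using order_trans ereal_less_eq(3) by blast
      qed
      moreover have "f u < z + c / 2" using u \<open>c > 0\<close> by (simp add: field_simps)
      ultimately show ?thesis using Inf_ereal_le_iff_ge[OF f E, of "z + c / 2" u] u E by force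
    qed
    thus ?thesis by (auto, meson order_trans, meson order_trans)
  qed
  ultimately show ?case using Suc by (simp add: hit_below_def)
qed

text \<open>Every pair is a fall by more than \<open>c\<close>, which by uniform continuity takes at
  least a time \<open>e\<close> independent of the level. The bound is uniform in \<open>z\<close>,
  as integration over \<open>z\<close> requires.\<close>

lemma down_alternates_bounded:
  assumes f: "continuous_on {s..t} f" and "c > 0"
  shows "\<exists>B. \<forall>z n v. v \<le> t \<longrightarrow> down_alternates z c f n s v \<longrightarrow> n \<le> (B::nat)"
proof -
  have "uniformly_continuous_on {s..t} f" using f by (intro compact_uniformly_continuous) auto
  then obtain e where e: "e > 0" "\<And>u v. u \<in> {s..t} \<Longrightarrow> v \<in> {s..t} \<Longrightarrow> dist v u < e \<Longrightarrow> dist (f v) (f u) < c"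
    unfolding uniformly_continuous_on_def using \<open>c > 0\<close> by metis
  have *: "s + n * e \<le> v" if "v \<le> t" "down_alternates z c f n s v" for z n v
    using that
  proof (induction n arbitrary: v)
    case (Suc n)
    then obtain w u where wu: "down_alternates z c f n s w" "w \<le> u" "u \<le> v" "z + c / 2 \<le> f u" "f v < z - c / 2"
      by auto
    have "s + n * e \<le> w" using Suc wu by auto
    moreover have "\<not> dist v u < e" using e(2)[of u v] wu alternates_ge[OF wu(1)] Suc.prems
      by (auto simp: dist_real_def)
    ultimately show ?case using wu(2,3) by (auto simp: dist_real_def algebra_simps)
  qed (auto)
  have "n \<le> nat \<lceil>(t - s) / e\<rceil>" if "v \<le> t" "down_alternates z c f n s v" for z n v
  proof -
    have "real n \<le> (t - s) / e" using *[OF that] e(1) that by (simp add: field_simps)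
    thus ?thesis by linarith
  qed
  thus ?thesis by blast
qed

text \<open>\<open>Max\<close> carries information only for finite nonempty sets:
  \<open>down_alternates_bounded\<close> gives finiteness, and 0 is always a member. Since chains
  can be shortened, the set is determined by its maximum.\<close>

lemma downcrossings_ge_iff:
  assumes f: "continuous_on {s..t} f" and "c > 0" and st: "s \<le> t"
  shows "n \<le> downcrossings z c f s t \<longleftrightarrow> (\<exists>v\<le>t. down_alternates z c f n s v)"
proof -
  let ?S = "{n. \<exists>v\<le>t. down_alternates z c f n s v}"
  have eq: "cross_sigma f s t z c n \<le> ereal t \<longleftrightarrow> n \<in> ?S" for n
  proof
    assume "cross_sigma f s t z c n \<le> ereal t"
    hence "{v. v \<le> t \<and> down_alternates z c f n s v} \<noteq> {}"
      unfolding cross_sigma_eq_Inf[OF assms]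
      by (metis (no_types, lifting) Inf_empty PInfty_neq_ereal(1) ereal_infty_less_eq(1) image_empty top_ereal_def)
    thus "n \<in> ?S" by auto
  next
    assume "n \<in> ?S"
    thus "cross_sigma f s t z c n \<le> ereal t"
      unfolding cross_sigma_eq_Inf[OF assms] by (auto intro: Inf_lower2)
  qed
  obtain B where "\<And>n. n \<in> ?S \<Longrightarrow> n \<le> B"
    using down_alternates_bounded[OF f \<open>c > 0\<close>] by blast
  hence fin: "finite ?S" by (meson finite_nat_set_iff_bounded_le)
  have ne: "0 \<in> ?S" using st by auto
  have dc: "downcrossings z c f s t = Max ?S" unfolding downcrossings_def eq by simp
  show ?thesis
  proof
    assume "n \<le> downcrossings z c f s t"
    moreover have "Max ?S \<in> ?S" using fin ne by (intro Max_in) blast+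
    ultimately show "\<exists>v\<le>t. down_alternates z c f n s v"
      unfolding dc using alternates_mono by (smt (verit, ccfv_threshold) mem_Collect_eq)
  next
    assume "\<exists>v\<le>t. down_alternates z c f n s v"
    thus "n \<le> downcrossings z c f s t" unfolding dc using fin by (intro Max_ge) auto
  qed
qed

section \<open>Downcrossings under cutting of time and affine changes\<close>

lemma continuous_on_subinterval:
  fixes f :: "real \<Rightarrow> real"
  assumes "continuous_on {s..t} f" "s \<le> m" "m \<le> t"
  shows "continuous_on {s..m} f" "continuous_on {m..t} f"
  using assms by (auto elim: continuous_on_subset)

lemma downcrossings_superadd:
  assumes f: "continuous_on {s..t} f" and "c > 0" and m: "s \<le> m" "m \<le> t"
  shows "downcrossings z c f s m + downcrossings z c f m t \<le> downcrossings z c f s t"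
proof -
  obtain w v where "w \<le> m" "down_alternates z c f (downcrossings z c f s m) s w"
    "v \<le> t" "down_alternates z c f (downcrossings z c f m t) m v"
    using downcrossings_ge_iff[OF continuous_on_subinterval(1)[OF f m] \<open>c > 0\<close> m(1), of _ z]
      downcrossings_ge_iff[OF continuous_on_subinterval(2)[OF f m] \<open>c > 0\<close> m(2), of _ z] by blast
  thus ?thesis
    using alternates_append downcrossings_ge_iff[OF f \<open>c > 0\<close> order_trans[OF m]]
    by (meson order_trans)
qed

text \<open>A longest chain is cut at \<open>m\<close>. The exceptional band is half-open because a
  high point is defined by a weak and a low point by a strict inequality; outside it
  \<open>m\<close> itself completes a straddling pair.\<close>

lemma downcrossings_subadd:
  assumes f: "continuous_on {s..t} f" and "c > 0" and m: "s \<le> m" "m \<le> t"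
  shows "downcrossings z c f s t \<le> Suc (downcrossings z c f s m + downcrossings z c f m t)"
    and "f m \<notin> {z - c / 2..<z + c / 2} \<Longrightarrow>
      downcrossings z c f s t \<le> downcrossings z c f s m + downcrossings z c f m t"
proof -
  let ?n = "downcrossings z c f s t"
  note 1 = downcrossings_ge_iff[OF continuous_on_subinterval(1)[OF f m] \<open>c > 0\<close> m(1), of _ z]
  note 2 = downcrossings_ge_iff[OF continuous_on_subinterval(2)[OF f m] \<open>c > 0\<close> m(2), of _ z]
  obtain v where v: "v \<le> t" "down_alternates z c f ?n s v"
    using downcrossings_ge_iff[OF f \<open>c > 0\<close> order_trans[OF m], of ?n z] by auto
  have "?n \<le> Suc (downcrossings z c f s m + downcrossings z c f m t) \<and>
    (f m \<notin> {z - c / 2..<z + c / 2} \<longrightarrow> ?n \<le> downcrossings z c f s m + downcrossings z c f m t)"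
  proof (cases "m \<le> v")
    case True
    from alternates_split[OF v(2) m(1) True] obtain i k w where
      *: "down_alternates z c f i s w" "w \<le> m" "down_alternates z c f k m v" "?n \<le> Suc (i + k)"
      "f m \<ge> z + c / 2 \<or> f m < z - c / 2 \<longrightarrow> ?n \<le> i + k" by blast
    have "i \<le> downcrossings z c f s m" "k \<le> downcrossings z c f m t"
      using * v 1 2 by blast+
    thus ?thesis using *(4,5) by auto
  next
    case False
    hence "?n \<le> downcrossings z c f s m" using v 1 by force
    thus ?thesis by simp
  qed
  thus "?n \<le> Suc (downcrossings z c f s m + downcrossings z c f m t)"
    "f m \<notin> {z - c / 2..<z + c / 2} \<Longrightarrow> ?n \<le> downcrossings z c f s m + downcrossings z c f m t" by auto
qed

text \<open>Positive factors preserve the order of times and of values, so chains for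
  \<open>f\<close> and for \<open>F\<close> match.\<close>

lemma downcrossings_affine:
  assumes f: "continuous_on {s..t} f" and "c > 0" and st: "s \<le> t" and "b > 0" "\<gamma> > 0"
    and F: "\<And>u. u \<in> {s..t} \<Longrightarrow> F (\<alpha> + \<gamma> * u) = a + b * f u"
    and F': "continuous_on {\<alpha> + \<gamma> * s..\<alpha> + \<gamma> * t} F"
  shows "downcrossings (a + b * z) (b * c) F (\<alpha> + \<gamma> * s) (\<alpha> + \<gamma> * t) = downcrossings z c f s t"
proof -
  have "(\<exists>v\<le>\<alpha> + \<gamma> * t. down_alternates (a + b * z) (b * c) F n (\<alpha> + \<gamma> * s) v) \<longleftrightarrow>
      (\<exists>v\<le>t. down_alternates z c f n s v)" for n
  proof -
    have "(\<exists>v\<le>\<alpha> + \<gamma> * t. down_alternates (a + b * z) (b * c) F n (\<alpha> + \<gamma> * s) v) \<longleftrightarrow>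
      (\<exists>v\<le>t. down_alternates (a + b * z) (b * c) F n (\<alpha> + \<gamma> * s) (\<alpha> + \<gamma> * v))" (is "?l \<longleftrightarrow> ?r")
    proof
      assume ?l
      then obtain v where "v \<le> \<alpha> + \<gamma> * t" "down_alternates (a + b * z) (b * c) F n (\<alpha> + \<gamma> * s) v" by blast
      thus ?r using \<open>\<gamma> > 0\<close> by (intro exI[of _ "(v - \<alpha>) / \<gamma>"]) (auto simp: field_simps)
    next
      assume ?r
      then obtain v where "v \<le> t" "down_alternates (a + b * z) (b * c) F n (\<alpha> + \<gamma> * s) (\<alpha> + \<gamma> * v)" by blast
      thus ?l using \<open>\<gamma> > 0\<close> by (intro exI[of _ "\<alpha> + \<gamma> * v"]) simp
    qed
    also have "\<dots> \<longleftrightarrow> (\<exists>v\<le>t. down_alternates z c f n s v)"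
    proof (rule ex_cong1, rule conj_cong[OF refl])
      fix v assume v: "v \<le> t"
      have 1: "F (\<alpha> + \<gamma> * u) \<ge> a + b * z + b * c / 2 \<longleftrightarrow> f u \<ge> z + c / 2" 
        "F (\<alpha> + \<gamma> * u) < a + b * z - b * c / 2 \<longleftrightarrow> f u < z - c / 2" if "s \<le> u" "u \<le> t" for u
      proof -
        have "a + b * z + b * c / 2 = a + b * (z + c / 2)" "a + b * z - b * c / 2 = a + b * (z - c / 2)"
          by (simp_all add: algebra_simps)
        thus "F (\<alpha> + \<gamma> * u) \<ge> a + b * z + b * c / 2 \<longleftrightarrow> f u \<ge> z + c / 2" 
          "F (\<alpha> + \<gamma> * u) < a + b * z - b * c / 2 \<longleftrightarrow> f u < z - c / 2"
          using F[of u] that \<open>b > 0\<close> by simp_all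
      qed
      show "down_alternates (a + b * z) (b * c) F n (\<alpha> + \<gamma> * s) (\<alpha> + \<gamma> * v) \<longleftrightarrow> down_alternates z c f n s v"
        unfolding alternates_affine[OF \<open>\<gamma> > 0\<close>]
        by (rule alternates_cong[OF _ v]) (use 1 in auto)
    qed
    finally show ?thesis .
  qed
  hence "n \<le> downcrossings (a + b * z) (b * c) F (\<alpha> + \<gamma> * s) (\<alpha> + \<gamma> * t) \<longleftrightarrow>
      n \<le> downcrossings z c f s t" for n
    using downcrossings_ge_iff[OF f \<open>c > 0\<close> st, of n z]
      downcrossings_ge_iff[OF F', of "b * c" n "a + b * z"] assms(2-5) by simp
  thus ?thesis by (meson order_antisym order_refl)
qed

lemma downcrossings_bounded:
  assumes f: "continuous_on {s..t} f" and "c > 0" and st: "s \<le> t"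
  shows "\<exists>B. \<forall>z. downcrossings z c f s t \<le> B"
  using down_alternates_bounded[OF f \<open>c > 0\<close>] downcrossings_ge_iff[OF f \<open>c > 0\<close> st] by blast

lemma downcrossings_eq_0:
  assumes f: "continuous_on {s..t} f" and "c > 0" and st: "s \<le> t"
    and no: "\<And>u v. s \<le> u \<Longrightarrow> u \<le> v \<Longrightarrow> v \<le> t \<Longrightarrow> f u \<ge> z + c / 2 \<Longrightarrow> f v < z - c / 2 \<Longrightarrow> False"
  shows "downcrossings z c f s t = 0"
proof -
  have "\<not> 1 \<le> downcrossings z c f s t"
    unfolding downcrossings_ge_iff[OF assms(1-3)] using no by (auto, meson order_trans)
  thus ?thesis by simp
qed

text \<open>A second downcrossing would need a rise from low to high after the first one, which
  \<open>no\<close> forbids.\<close>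

lemma downcrossings_eq_1:
  assumes f: "continuous_on {s..t} f" and "c > 0" and st: "s \<le> t"
    and ends: "f s \<ge> z + c / 2" "f t < z - c / 2"
    and no: "\<And>u v. s \<le> u \<Longrightarrow> u \<le> v \<Longrightarrow> v \<le> t \<Longrightarrow> f u < z - c / 2 \<Longrightarrow> f v \<ge> z + c / 2 \<Longrightarrow> False"
  shows "downcrossings z c f s t = 1"
proof -
  have "1 \<le> downcrossings z c f s t"
    unfolding downcrossings_ge_iff[OF assms(1-3)] using st ends by auto
  moreover have "\<not> 2 \<le> downcrossings z c f s t"
    unfolding downcrossings_ge_iff[OF assms(1-3)] using no alternates_ge
    by (auto simp: numeral_2_eq_2) (smt (verit))
  ultimately show ?thesis by simp
qed

text \<open>Each point of \<open>S - interior S\<close> is the right end of an interval inside \<open>interior S\<close>. These intervals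
  are disjoint, so there are only countably many such points.\<close>

lemma left_neighbourhoods_borel:
  fixes S :: "real set"
  assumes S: "\<And>z. z \<in> S \<Longrightarrow> \<exists>e>0. {z - e..z} \<subseteq> S"
  shows "S \<in> sets borel"
proof -
  let ?A = "S - interior S"
  have "\<exists>q::rat. of_rat q < z \<and> {of_rat q<..<z} \<subseteq> interior S" if "z \<in> ?A" for z
  proof -
    have "z \<in> S" using that by simp
    from S[OF this] obtain e where e: "e > 0" "{z - e..z} \<subseteq> S" by blast
    obtain q :: rat where q: "z - e < of_rat q" "of_rat q < z" using of_rat_dense[of "z - e" z] e by auto
    have "{of_rat q<..<z} \<subseteq> interior S" using q e(2) by (intro interior_maximal) auto
    thus ?thesis using q by blast
  qed
  hence "\<exists>q :: real \<Rightarrow> rat. \<forall>z\<in>?A. of_rat (q z) < z \<and> {of_rat (q z)<..<z} \<subseteq> interior S"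
    by (intro bchoice) blast
  then obtain q :: "real \<Rightarrow> rat"
    where q: "\<And>z. z \<in> ?A \<Longrightarrow> of_rat (q z) < z \<and> {of_rat (q z)<..<z} \<subseteq> interior S"
    by blast
  have *: False if "z \<in> ?A" "z' \<in> ?A" "q z = q z'" "z < z'" for z z'
  proof -
    have "z \<in> {of_rat (q z')<..<z'}" using q[OF that(1)] that by auto
    thus False using q[OF that(2)] that(1) by auto
  qed
  have "inj_on q ?A" 
  proof (rule inj_onI)
    fix z z' assume "z \<in> ?A" "z' \<in> ?A" "q z = q z'"
    thus "z = z'" using *[of z z'] *[of z' z] by (cases z z' rule: linorder_cases) simp_all
  qed
  hence count: "countable ?A" by (rule countableI')
  have "?A \<in> sets borel"
    by (rule sets.countable[OF _ count]) (rule borel_closed, rule closed_singleton)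
  moreover have "S = interior S \<union> ?A" using interior_subset by auto
  moreover have "interior S \<in> sets borel" by auto
  ultimately show ?thesis using sets.Un[of "interior S" borel ?A] by simp
qed

text \<open>Lowering the level only helps the weak upper inequalities, and the finitely many strict
  lower ones leave room. This supplies the hypothesis of
  \<open>left_neighbourhoods_borel\<close>.\<close>

lemma down_alternates_left:
  "down_alternates z c f n s v \<Longrightarrow> \<exists>e>0. \<forall>z'\<in>{z - e..z}. down_alternates z' c f n s v"
proof (induction n arbitrary: v)
  case 0
  thus ?case by (intro exI[of _ 1]) auto
next
  case (Suc n)
  then obtain w u where *: "down_alternates z c f n s w" "w \<le> u" "u \<le> v" "z + c / 2 \<le> f u" "f v < z - c / 2"
    by auto
  then obtain e where e: "e > 0" "\<forall>z'\<in>{z - e..z}. down_alternates z' c f n s w" using Suc.IH by blast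
  \<comment> \<open>Half of the slack in the strict inequality at \<open>v\<close>, so that it
    survives the lowering.\<close>
  let ?e = "min e ((z - c / 2 - f v) / 2)"
  have "down_alternates z' c f (Suc n) s v" if "z' \<in> {z - ?e..z}" for z'
  proof -
    have "down_alternates z' c f n s w" using e that by auto
    moreover have "z' + c / 2 \<le> f u" "f v < z' - c / 2" using that * by (auto simp: min_def field_simps split: if_splits)
    ultimately show ?thesis using * by auto
  qed
  moreover have "?e > 0" using e * by simp
  ultimately show ?case by blast
qed

lemma downcrossings_measurable:
  assumes "continuous_on {s..t} f" "c > 0" "s \<le> t"
  shows "(\<lambda>z. real (downcrossings z c f s t)) \<in> borel_measurable borel"
proof -
  have "{z. n \<le> downcrossings z c f s t} \<in> sets borel" for n
    unfolding downcrossings_ge_iff[OF assms]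
    by (rule left_neighbourhoods_borel) (use down_alternates_left in blast)
  hence "(\<lambda>z. downcrossings z c f s t) -` {n} \<inter> space borel \<in> sets borel" for n
  proof -
    have "(\<lambda>z. downcrossings z c f s t) -` {n} \<inter> space borel =
      {z. n \<le> downcrossings z c f s t} - {z. Suc n \<le> downcrossings z c f s t}" by auto
    thus ?thesis using \<open>\<And>n. {z. n \<le> downcrossings z c f s t} \<in> sets borel\<close> by simp
  qed
  hence "(\<lambda>z. downcrossings z c f s t) \<in> borel \<rightarrow>\<^sub>M count_space UNIV"
    by (intro measurable_count_space_eq2_countable[THEN iffD2]) auto
  thus ?thesis by (rule measurable_compose) auto
qed

section \<open>Crossings in both directions\<close>

lemma crossings_minus: "crossings (- z) c (\<lambda>u. - f u) s t = crossings z c f s t"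
  by (simp add: crossings_def upcrossings_def)

lemma crossings_superadd:
  assumes f: "continuous_on {s..t} f" and c: "c > 0" and m: "s \<le> m" "m \<le> t"
  shows "crossings z c f s m + crossings z c f m t \<le> crossings z c f s t"
  using downcrossings_superadd[OF f c m, of z]
    downcrossings_superadd[OF continuous_on_minus[OF f] c m, of "- z"]
  by (simp add: crossings_def upcrossings_def)

text \<open>Each direction may lose one crossing at \<open>m\<close>. The closed band covers the
  half-open band of \<open>f\<close> and the reflected one of \<open>- f\<close>, so outside it
  neither direction loses any.\<close>

lemma crossings_subadd:
  assumes f: "continuous_on {s..t} f" and c: "c > 0" and m: "s \<le> m" "m \<le> t"
  shows "crossings z c f s t \<le> crossings z c f s m + crossings z c f m t + 2"
    and "f m \<notin> {z - c / 2..z + c / 2} \<Longrightarrow>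
      crossings z c f s t = crossings z c f s m + crossings z c f m t"
proof -
  note d = downcrossings_subadd[OF f c m, of z]
    and u = downcrossings_subadd[OF continuous_on_minus[OF f] c m, of "- z"]
  show "crossings z c f s t \<le> crossings z c f s m + crossings z c f m t + 2"
    using d(1) u(1) by (simp add: crossings_def upcrossings_def)
  assume "f m \<notin> {z - c / 2..z + c / 2}"
  hence "f m \<notin> {z - c / 2..<z + c / 2}" "- f m \<notin> {- z - c / 2..<- z + c / 2}" by auto
  from d(2)[OF this(1)] u(2)[OF this(2)]
  have "crossings z c f s t \<le> crossings z c f s m + crossings z c f m t"
    by (simp add: crossings_def upcrossings_def)
  thus "crossings z c f s t = crossings z c f s m + crossings z c f m t"
    using crossings_superadd[OF f c m, of z] by simp
qed

text \<open>Induction on the number \<open>n\<close> of interior partition points, each of which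
  costs at most two crossings.\<close>

lemma crossings_partition:
  fixes p :: "nat \<Rightarrow> real"
  assumes p: "mono p" and f: "continuous_on {p 0..p (Suc n)} f" and c: "c > 0"
  shows "(\<Sum>i\<le>n. crossings z c f (p i) (p (Suc i))) \<le> crossings z c f (p 0) (p (Suc n))"
    and "crossings z c f (p 0) (p (Suc n)) \<le> (\<Sum>i\<le>n. crossings z c f (p i) (p (Suc i))) + 2 * n"
    and "(\<And>i. 1 \<le> i \<Longrightarrow> i \<le> n \<Longrightarrow> f (p i) \<notin> {z - c / 2..z + c / 2}) \<Longrightarrow>
      crossings z c f (p 0) (p (Suc n)) = (\<Sum>i\<le>n. crossings z c f (p i) (p (Suc i)))"
proof -
  have "(\<Sum>i\<le>n. crossings z c f (p i) (p (Suc i))) \<le> crossings z c f (p 0) (p (Suc n)) \<and>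
    crossings z c f (p 0) (p (Suc n)) \<le> (\<Sum>i\<le>n. crossings z c f (p i) (p (Suc i))) + 2 * n \<and>
    ((\<forall>i. 1 \<le> i \<longrightarrow> i \<le> n \<longrightarrow> f (p i) \<notin> {z - c / 2..z + c / 2}) \<longrightarrow>
      crossings z c f (p 0) (p (Suc n)) = (\<Sum>i\<le>n. crossings z c f (p i) (p (Suc i))))"
    using f
  proof (induction n)
    case (Suc n)
    have le: "p 0 \<le> p (Suc n)" "p (Suc n) \<le> p (Suc (Suc n))" using p by (auto simp: mono_def)
    hence "continuous_on {p 0..p (Suc n)} f" using Suc.prems by (elim continuous_on_subset) auto
    note IH = Suc.IH[OF this]
    show ?case
      using IH crossings_superadd[OF Suc.prems c le, of z] crossings_subadd[OF Suc.prems c le, of z]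
      by auto
  qed simp
  thus "(\<Sum>i\<le>n. crossings z c f (p i) (p (Suc i))) \<le> crossings z c f (p 0) (p (Suc n))"
    "crossings z c f (p 0) (p (Suc n)) \<le> (\<Sum>i\<le>n. crossings z c f (p i) (p (Suc i))) + 2 * n"
    "(\<And>i. 1 \<le> i \<Longrightarrow> i \<le> n \<Longrightarrow> f (p i) \<notin> {z - c / 2..z + c / 2}) \<Longrightarrow>
      crossings z c f (p 0) (p (Suc n)) = (\<Sum>i\<le>n. crossings z c f (p i) (p (Suc i)))"
    by blast+
qed

lemma crossings_affine:
  assumes f: "continuous_on {s..t} f" and c: "c > 0" and st: "s \<le> t" and pos: "b > 0" "\<gamma> > 0"
    and F: "\<And>u. u \<in> {s..t} \<Longrightarrow> F (\<alpha> + \<gamma> * u) = a + b * f u"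
    and F': "continuous_on {\<alpha> + \<gamma> * s..\<alpha> + \<gamma> * t} F"
  shows "crossings (a + b * z) (b * c) F (\<alpha> + \<gamma> * s) (\<alpha> + \<gamma> * t) = crossings z c f s t"
  using downcrossings_affine[OF f c st pos, of F \<alpha> a z] F F'
    downcrossings_affine[OF continuous_on_minus[OF f] c st pos, of "\<lambda>u. - F u" \<alpha> "- a" "- z"]
    continuous_on_minus[OF F']
  by (simp add: crossings_def upcrossings_def)

lemma crossings_bounded:
  assumes f: "continuous_on {s..t} f" and c: "c > 0" and st: "s \<le> t"
  shows "\<exists>B. \<forall>z. crossings z c f s t \<le> B"
proof -
  obtain B1 where "\<And>z. downcrossings z c f s t \<le> B1"
    using downcrossings_bounded[OF f c st] by blast
  moreover obtain B2 where "\<And>z. downcrossings z c (\<lambda>u. - f u) s t \<le> B2"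
    using downcrossings_bounded[OF continuous_on_minus[OF f] c st] by blast
  ultimately show ?thesis
    unfolding crossings_def upcrossings_def by (intro exI[of _ "B2 + B1"] allI add_mono)
qed

lemma crossings_measurable:
  assumes f: "continuous_on {s..t} f" and c: "c > 0" and st: "s \<le> t"
  shows "(\<lambda>z. real (crossings z c f s t)) \<in> borel_measurable borel"
proof -
  have "(\<lambda>z. real (downcrossings (- z) c (\<lambda>u. - f u) s t)) \<in> borel_measurable borel"
    using downcrossings_measurable[OF continuous_on_minus[OF f] c st]
    by (rule measurable_compose[rotated]) simp
  thus ?thesis
    using downcrossings_measurable[OF f c st] by (simp add: crossings_def upcrossings_def)
qed

lemma crossings_eq_0:
  assumes f: "continuous_on {s..t} f" and c: "c > 0" and st: "s \<le> t"
    and no: "(\<forall>u\<in>{s..t}. f u < z + c / 2) \<or> (\<forall>u\<in>{s..t}. f u > z - c / 2)"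
  shows "crossings z c f s t = 0"
proof -
  have no': "f u < z + c / 2 \<or> f v > z - c / 2" if "s \<le> u" "u \<le> t" "s \<le> v" "v \<le> t" for u v
    using no that by auto
  have "downcrossings z c f s t = 0"
  proof (rule downcrossings_eq_0[OF f c st])
    fix u v assume "s \<le> u" "u \<le> v" "v \<le> t" "f u \<ge> z + c / 2" "f v < z - c / 2"
    thus False using no'[of u v] by simp
  qed
  moreover have "downcrossings (- z) c (\<lambda>u. - f u) s t = 0"
  proof (rule downcrossings_eq_0[OF continuous_on_minus[OF f] c st])
    fix u v assume "s \<le> u" "u \<le> v" "v \<le> t" "- f u \<ge> - z + c / 2" "- f v < - z - c / 2"
    thus False using no'[of v u] by simp
  qed
  ultimately show ?thesis by (simp add: crossings_def upcrossings_def)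
qed

text \<open>The ends supply one upcrossing. With its weak inequalities, \<open>no\<close> excludes
  every downcrossing and also the fall that a second upcrossing would need.\<close>

lemma crossings_eq_1:
  assumes f: "continuous_on {s..t} f" and c: "c > 0" and st: "s \<le> t"
    and ends: "f s < z - c / 2" "f t > z + c / 2"
    and no: "\<And>u v. s \<le> u \<Longrightarrow> u \<le> v \<Longrightarrow> v \<le> t \<Longrightarrow> f u \<ge> z + c / 2 \<Longrightarrow> f v \<le> z - c / 2 \<Longrightarrow> False"
  shows "crossings z c f s t = 1"
proof -
  have "downcrossings z c f s t = 0"
    by (rule downcrossings_eq_0[OF f c st]) (use no in force)
  moreover have "downcrossings (- z) c (\<lambda>u. - f u) s t = 1"
    by (rule downcrossings_eq_1[OF continuous_on_minus[OF f] c st]) (use ends no in force)+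
  ultimately show ?thesis by (simp add: crossings_def upcrossings_def)
qed

section \<open>Self-similar time cells\<close>

text \<open>Iteration of \<open>peano_x_ninth\<close>: \<open>a\<close> is the left edge of the
  column and \<open>b\<close> records whether the copy is unreflected.\<close>

lemma peano_x_cell:
  assumes "i < 9 ^ m"
  shows "\<exists>a b. \<forall>s\<in>{0..1}.
    peano_x ((real i + s) / 9 ^ m) = a + (if b then peano_x s else 1 - peano_x s) / 3 ^ m"
  using assms
proof (induction m arbitrary: i)
  case 0
  show ?case by (rule exI[of _ 0], rule exI[of _ True]) (use 0 in auto)
next
  case (Suc m)
  \<comment> \<open>The parent cell is \<open>q\<close>, and the last base-9 digit of
    \<open>i\<close> consists of the two ternary digits \<open>k\<close> and
    \<open>j\<close>.\<close>
  define q k j where "q = i div 9" and "k = i mod 9 div 3" and "j = i mod 3"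
  have kj: "k \<le> 2" "j \<le> 2" "i = 9 * q + (3 * k + j)"
    unfolding q_def k_def j_def by presburger+
  have "q < 9 ^ m" using Suc.prems unfolding q_def by (simp add: div_less_iff_less_mult mult.commute)
  then obtain a b where ab: "\<And>s. s \<in> {0..1} \<Longrightarrow>
    peano_x ((real q + s) / 9 ^ m) = a + (if b then peano_x s else 1 - peano_x s) / 3 ^ m"
    using Suc.IH by blast
  show ?case
  proof (rule exI[of _ "a + (if b then real k else 2 - real k) / 3 ^ Suc m"],
      rule exI[of _ "b = even j"], rule ballI)
    fix s :: real assume s: "s \<in> {0..1}"
    define r where "r = (3 * real k + real j + s) / 9"
    have "r \<in> {0..1}" using s kj(1,2) unfolding r_def by auto
    have eq: "(real i + s) / 9 ^ Suc m = (real q + r) / 9 ^ m"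
      unfolding r_def kj(3) by (simp add: field_simps)
    have x_r: "peano_x r = (real k + (if even j then peano_x s else 1 - peano_x s)) / 3"
      unfolding r_def by (rule peano_x_ninth[OF s kj(1,2)])
    show "peano_x ((real i + s) / 9 ^ Suc m) = a + (if b then real k else 2 - real k) / 3 ^ Suc m +
        (if b = even j then peano_x s else 1 - peano_x s) / 3 ^ Suc m"
      unfolding eq ab[OF \<open>r \<in> {0..1}\<close>] x_r
      by (cases b; cases "even j") (simp_all add: field_simps)
  qed
qed

text \<open>The affine copy of [0,1] in \<open>peano_x_cell\<close> has width
  \<open>1 / 3 ^ m\<close>, and both values lie in it.\<close>

lemma peano_x_cell_oscillation:
  assumes i: "i < 9 ^ m" and t: "t \<in> {real i / 9 ^ m..(real i + 1) / 9 ^ m}"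
    and t': "t' \<in> {real i / 9 ^ m..(real i + 1) / 9 ^ m}"
  shows "\<bar>peano_x t - peano_x t'\<bar> \<le> 1 / 3 ^ m"
proof -
  obtain a b where ab: "\<And>s. s \<in> {0..1} \<Longrightarrow>
    peano_x ((real i + s) / 9 ^ m) = a + (if b then peano_x s else 1 - peano_x s) / 3 ^ m"
    using peano_x_cell[OF i] by blast
  have *: "peano_x u \<in> {a..a + 1 / 3 ^ m}" if u: "u \<in> {real i / 9 ^ m..(real i + 1) / 9 ^ m}" for u
  proof -
    have s: "9 ^ m * u - real i \<in> {0..1}" using u by (auto simp: field_simps)
    thus ?thesis using ab[OF s] peano_x_bounds[OF s] by (auto simp: divide_right_mono)
  qed
  show ?thesis using *[OF t] *[OF t'] by (auto simp: abs_le_iff)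
qed

section \<open>Modulus of continuity\<close>

lemma unit_interval_cell:
  assumes "t \<in> {0..1::real}" "n > 0"
  shows "\<exists>i<n. t \<in> {real i / real n..(real i + 1) / real n}"
proof (cases "t = 1")
  case True
  thus ?thesis using assms(2) by (intro exI[of _ "n - 1"]) (auto simp: of_nat_diff field_simps)
next
  case False
  define i where "i = nat \<lfloor>real n * t\<rfloor>"
  have "real n * t < real n * 1" using assms False by (intro mult_strict_left_mono) auto
  moreover have i: "real i \<le> real n * t" "real n * t \<le> real i + 1"
    using assms unfolding i_def by (auto simp: of_nat_nat)
  ultimately have "i < n" by linarith
  thus ?thesis using i assms(2) by (intro exI[of _ i]) (auto simp: field_simps)
qed

text \<open>Two such times lie in the same cell or in adjacent ones; in the latter case the path
  goes through the common endpoint.\<close>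

lemma peano_x_modulus:
  assumes t: "t \<in> {0..1}" and t': "t' \<in> {0..1}" and "\<bar>t - t'\<bar> \<le> 1 / 9 ^ m"
  shows "\<bar>peano_x t - peano_x t'\<bar> \<le> 2 / 3 ^ m"
proof -
  have *: "\<bar>peano_x t - peano_x t'\<bar> \<le> 2 / 3 ^ m"
    if t: "t \<in> {0..1}" and t': "t' \<in> {0..1}" and le: "t \<le> t'" "t' \<le> t + 1 / 9 ^ m" for t t'
  proof -
    obtain i where i: "i < 9 ^ m" "t \<in> {real i / 9 ^ m..(real i + 1) / 9 ^ m}"
      using unit_interval_cell[OF t, of "9 ^ m"] by auto
    let ?e = "(real i + 1) / 9 ^ m"
    have e: "?e \<in> {real i / 9 ^ m..(real i + 1) / 9 ^ m}" by (auto simp: field_simps)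
    show ?thesis
    proof (cases "t' \<le> ?e")
      case True
      have "\<bar>peano_x t - peano_x t'\<bar> \<le> 1 / 3 ^ m"
        using True le i by (intro peano_x_cell_oscillation[OF i]) auto
      also have "\<dots> \<le> 2 / 3 ^ m" by (simp add: divide_right_mono)
      finally show ?thesis .
    next
      case False
      have "?e < t'" using False by simp
      also have "t' \<le> 1" using t' by simp
      finally have "real (Suc i) < real (9 ^ m)" by (simp add: divide_less_eq)
      hence i': "Suc i < 9 ^ m" by (simp only: of_nat_less_iff)
      have "?e \<in> {real (Suc i) / 9 ^ m..(real (Suc i) + 1) / 9 ^ m}"
        by (auto simp: field_simps)
      moreover have "t' \<le> ?e + 1 / 9 ^ m" using i(2) le by auto
      hence "t' \<in> {real (Suc i) / 9 ^ m..(real (Suc i) + 1) / 9 ^ m}"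
        using False by (auto simp: add_divide_distrib)
      ultimately have "\<bar>peano_x ?e - peano_x t'\<bar> \<le> 1 / 3 ^ m"
        by (rule peano_x_cell_oscillation[OF i'])
      moreover have "\<bar>peano_x t - peano_x ?e\<bar> \<le> 1 / 3 ^ m"
        by (rule peano_x_cell_oscillation[OF i e])
      ultimately show ?thesis by linarith
    qed
  qed
  show ?thesis
  proof (cases "t \<le> t'")
    case True
    thus ?thesis using *[OF t t'] assms(3) by auto
  next
    case False
    thus ?thesis using *[OF t' t] assms(3) by (auto simp: abs_minus_commute)
  qed
qed

lemma continuous_on_peano_x: "continuous_on {0..1} peano_x"
  unfolding continuous_on_iff
proof (intro ballI allI impI)
  fix t e :: real assume t: "t \<in> {0..1}" and e: "e > 0"
  obtain m where "(1/3) ^ m < e / 2" using real_arch_pow_inv[of "e / 2" "1/3"] e by auto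
  hence m: "2 / 3 ^ m < e" by (simp add: power_divide)
  have "dist (peano_x t') (peano_x t) < e" if "t' \<in> {0..1}" "dist t' t < 1 / 9 ^ m" for t'
    using peano_x_modulus[OF that(1) t, of m] that(2) m by (auto simp: dist_real_def)
  thus "\<exists>d>0. \<forall>t'\<in>{0..1}. dist t' t < d \<longrightarrow> dist (peano_x t') (peano_x t) < e"
    by (intro exI[of _ "1 / 9 ^ m"]) auto
qed

lemma continuous_on_peano_x_subinterval:
  "0 \<le> s \<Longrightarrow> t \<le> 1 \<Longrightarrow> continuous_on {s..t} peano_x"
  by (rule continuous_on_subset[OF continuous_on_peano_x]) auto

text \<open>The sign of \<open>\<beta>\<close> is the orientation of the cell. The offset
  \<open>\<alpha>\<close> stays unspecified because it disappears when integrating over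
  \<open>z\<close>.\<close>

lemma crossings_peano_x_cell:
  assumes i: "i < 9 ^ m"
  shows "\<exists>\<alpha> \<beta>. \<bar>\<beta>\<bar> = 3 ^ m \<and> (\<forall>z c. c > 0 \<longrightarrow>
    crossings z c peano_x (real i / 9 ^ m) ((real i + 1) / 9 ^ m) =
    crossings (\<alpha> + \<beta> * z) (3 ^ m * c) peano_x 0 1)"
proof -
  obtain a b where ab: "\<And>s. s \<in> {0..1} \<Longrightarrow>
    peano_x ((real i + s) / 9 ^ m) = a + (if b then peano_x s else 1 - peano_x s) / 3 ^ m"
    using peano_x_cell[OF i] by blast
  let ?l = "real i / 9 ^ m"
  have ends: "?l + 1 / 9 ^ m * 0 = ?l" "?l + 1 / 9 ^ m * 1 = (real i + 1) / 9 ^ m"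
    by (simp_all add: add_divide_distrib)
  have "real i + 1 = real (Suc i)" by simp
  also have "\<dots> \<le> real (9 ^ m)" using i by (intro of_nat_mono) simp
  finally have "continuous_on {?l..(real i + 1) / 9 ^ m} peano_x"
    by (intro continuous_on_peano_x_subinterval) auto
  note cont = this
  have *: "crossings (a' + 1 / 3 ^ m * w) (1 / 3 ^ m * (3 ^ m * c)) peano_x ?l ((real i + 1) / 9 ^ m) =
      crossings w (3 ^ m * c) f 0 1"
    if "continuous_on {0..1} f" "c > 0"
      "\<And>s. s \<in> {0..1} \<Longrightarrow> peano_x (?l + 1 / 9 ^ m * s) = a' + 1 / 3 ^ m * f s" for a' w c f
    using crossings_affine[of 0 1 f "3 ^ m * c" "1 / 3 ^ m" "1 / 9 ^ m" peano_x ?l a' w,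
        unfolded ends, OF that(1) _ _ _ _ that(3) cont] that(2) by simp
  have l: "?l + 1 / 9 ^ m * s = (real i + s) / 9 ^ m" for s by (simp add: add_divide_distrib)
  show ?thesis
  proof (cases b)
    case True
    have "crossings z c peano_x ?l ((real i + 1) / 9 ^ m) =
      crossings (- (3 ^ m * a) + 3 ^ m * z) (3 ^ m * c) peano_x 0 1" if "c > 0" for z c
    proof -
      have "peano_x (?l + 1 / 9 ^ m * s) = a + 1 / 3 ^ m * peano_x s" if "s \<in> {0..1}" for s
        unfolding l using ab[OF that] True by simp
      note *[OF continuous_on_peano_x \<open>c > 0\<close> this, of "- (3 ^ m * a) + 3 ^ m * z"]
      moreover have "a + 1 / 3 ^ m * (- (3 ^ m * a) + 3 ^ m * z) = z" by (simp add: field_simps)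
      ultimately show ?thesis by simp
    qed
    thus ?thesis by (intro exI[of _ "- (3 ^ m * a)"] exI[of _ "3 ^ m"]) auto
  next
    case False
    \<comment> \<open>\<open>crossings_affine\<close> needs a positive factor, so a reflected cell
      is treated as a copy of \<open>- peano_x\<close>; \<open>crossings_minus\<close> then undoes
      the sign.\<close>
    have "crossings z c peano_x ?l ((real i + 1) / 9 ^ m) =
      crossings (- ((3 ^ m * a + 1) + (- (3 ^ m)) * z)) (3 ^ m * c) (\<lambda>u. - peano_x u) 0 1" if "c > 0" for z c
    proof -
      have "peano_x (?l + 1 / 9 ^ m * s) = (a + 1 / 3 ^ m) + 1 / 3 ^ m * (- peano_x s)" if "s \<in> {0..1}" for s
        unfolding l using ab[OF that] False by (simp add: diff_divide_distrib)
      note *[OF continuous_on_minus[OF continuous_on_peano_x] \<open>c > 0\<close> this, of "- ((3 ^ m * a + 1) + (- (3 ^ m)) * z)"]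
      moreover have "(a + 1 / 3 ^ m) + 1 / 3 ^ m * (- ((3 ^ m * a + 1) + (- (3 ^ m)) * z)) = z"
        by (simp add: field_simps)
      ultimately show ?thesis by simp
    qed
    hence "crossings z c peano_x ?l ((real i + 1) / 9 ^ m) =
      crossings ((3 ^ m * a + 1) + (- (3 ^ m)) * z) (3 ^ m * c) peano_x 0 1" if "c > 0" for z c
      using that unfolding crossings_minus by simp
    thus ?thesis by (intro exI[of _ "3 ^ m * a + 1"] exI[of _ "- (3 ^ m)"]) auto
  qed
qed

section \<open>Mean number of crossings\<close>

lemma crossings_peano_x_outside:
  assumes "c > 0" "0 \<le> s" "s \<le> t" "t \<le> 1" "z - c / 2 < 0 \<or> z + c / 2 > 1"
  shows "crossings z c peano_x s t = 0"
proof (rule crossings_eq_0[OF continuous_on_peano_x_subinterval assms(1,3)])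
  have "peano_x u \<in> {0..1}" if "u \<in> {s..t}" for u
    using that assms by (intro peano_x_bounds) auto
  thus "(\<forall>u\<in>{s..t}. peano_x u < z + c / 2) \<or> (\<forall>u\<in>{s..t}. peano_x u > z - c / 2)"
    using assms(5) by force
qed (use assms in auto)

lemma integrable_bounded_unit_interval:
  fixes F :: "real \<Rightarrow> real"
  assumes "F \<in> borel_measurable borel" "\<And>z. z \<in> {0..1} \<Longrightarrow> \<bar>F z\<bar> \<le> B"
    "\<And>z. z \<notin> {0..1} \<Longrightarrow> F z = 0"
  shows "integrable lborel F"
  by (rule integrableI_bounded_set[where A = "{0..1}" and B = B]) (use assms in auto)

lemma integral_bounded_unit_interval:
  fixes F :: "real \<Rightarrow> real"
  assumes "integrable lborel F" "\<And>z. z \<in> {0..1} \<Longrightarrow> \<bar>F z\<bar> \<le> B"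
    "\<And>z. z \<notin> {0..1} \<Longrightarrow> F z = 0"
  shows "\<bar>LINT z|lborel. F z\<bar> \<le> B"
proof -
  have "\<bar>LINT z|lborel. F z\<bar> \<le> (LINT z|lborel. \<bar>F z\<bar>)"
    by (rule integral_abs_bound)
  also have "\<dots> \<le> (LINT z|lborel. B * indicator {0..1::real} z)"
  proof (rule Bochner_Integration.integral_mono)
    show "\<bar>F z\<bar> \<le> B * indicator {0..1} z" for z
      using assms(2,3)[of z] by (cases "z \<in> {0..1}") simp_all
  qed (use assms(1) in auto)
  finally show ?thesis by simp
qed

lemma crossings_peano_x_integrable:
  assumes "c > 0" "0 \<le> s" "s \<le> t" "t \<le> 1" "g \<in> borel_measurable borel"
    and G: "\<And>z. z \<in> {0..1} \<Longrightarrow> \<bar>g z\<bar> \<le> (G::real)"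
  shows "integrable lborel (\<lambda>z. real (crossings z c peano_x s t) * g z)"
proof -
  note cont = continuous_on_peano_x_subinterval[OF assms(2,4)]
  obtain B where B: "\<And>z. crossings z c peano_x s t \<le> B"
    using crossings_bounded[OF cont assms(1,3)] by blast
  show ?thesis
  proof (rule integrable_bounded_unit_interval)
    show "(\<lambda>z. real (crossings z c peano_x s t) * g z) \<in> borel_measurable borel"
      using crossings_measurable[OF cont assms(1,3)] assms(5) by measurable
    show "\<bar>real (crossings z c peano_x s t) * g z\<bar> \<le> real B * G" if "z \<in> {0..1}" for z
      using G[OF that] B[of z] by (auto simp: abs_mult intro!: mult_mono)
    show "real (crossings z c peano_x s t) * g z = 0" if "z \<notin> {0..1}" for z
      using crossings_peano_x_outside[OF assms(1-4), of z] that assms(1) by auto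
  qed
qed

lemma crossings_peano_x_integrable':
  assumes "c > 0" "0 \<le> s" "s \<le> t" "t \<le> 1"
  shows "integrable lborel (\<lambda>z. real (crossings z c peano_x s t))"
  using crossings_peano_x_integrable[OF assms, of "\<lambda>_. 1" 1] by simp

definition mean_crossings :: "real \<Rightarrow> real" where
  "mean_crossings c = (LINT z|lborel. real (crossings z c peano_x 0 1))"

text \<open>The affine substitution in \<open>z\<close> has Jacobian \<open>3 ^ m\<close> for either
  orientation.\<close>

lemma mean_crossings_cell:
  assumes "i < 9 ^ m" "c > 0"
  shows "(LINT z|lborel. real (crossings z c peano_x (real i / 9 ^ m) ((real i + 1) / 9 ^ m))) =
    mean_crossings (3 ^ m * c) / 3 ^ m"
proof -
  obtain \<alpha> \<beta> :: real where *: "\<bar>\<beta>\<bar> = 3 ^ m" "\<And>z. crossings z c peano_x (real i / 9 ^ m) ((real i + 1) / 9 ^ m) =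
    crossings (\<alpha> + \<beta> * z) (3 ^ m * c) peano_x 0 1"
    using crossings_peano_x_cell[OF assms(1)] assms(2) by blast
  have "\<beta> \<noteq> 0" using *(1) by auto
  have "mean_crossings (3 ^ m * c) =
      3 ^ m * (LINT z|lborel. real (crossings (\<alpha> + \<beta> * z) (3 ^ m * c) peano_x 0 1))"
    unfolding mean_crossings_def
    by (subst lborel_integral_real_affine[OF \<open>\<beta> \<noteq> 0\<close>, of _ \<alpha>]) (simp add: *(1))
  thus ?thesis unfolding *(2) by simp
qed

section \<open>Passage of the curve through the levels \<open>k / 3\<close>\<close>

lemma peano_x_third:
  assumes "k \<le> 3"
  shows "peano_x (real k / 3) = real k / 3"
proof (cases "k = 3")
  case False
  thus ?thesis using peano_x_ninth[of 0 k 0] assms peano_x_0 by (simp add: field_simps)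
qed (simp add: peano_x_1)

text \<open>The ninths making up the \<open>k\<close>-th third all have leading digit
  \<open>k\<close>, which fixes the column.\<close>

lemma peano_x_in_third:
  assumes "k < 3" "u \<in> {real k / 3..(real k + 1) / 3}"
  shows "peano_x u \<in> {real k / 3..(real k + 1) / 3}"
proof -
  have "3 * u - real k \<in> {0..1}" using assms by auto
  from unit_interval_cell[OF this, of 3] obtain j where
    j: "j < 3" "3 * u - real k \<in> {real j / 3..(real j + 1) / 3}" by auto
  define s where "s = 9 * u - 3 * real k - real j"
  have s: "s \<in> {0..1}" using j(2) by (auto simp: s_def)
  have u: "(3 * real k + real j + s) / 9 = u" by (simp add: s_def)
  show ?thesis
    using peano_x_ninth[OF s, of k j] assms j peano_x_bounds[OF s] unfolding u by auto
qed

text \<open>Earlier thirds lie in columns further left; the only other possibility is the boundary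
  time \<open>k / 3\<close>, where the value is \<open>k / 3\<close> as well.\<close>

lemma peano_x_le_third:
  assumes "k \<le> 3" "u \<in> {0..1}" "u \<le> real k / 3"
  shows "peano_x u \<le> real k / 3"
proof -
  obtain l where l: "l < 3" "u \<in> {real l / 3..(real l + 1) / 3}"
    using unit_interval_cell[OF assms(2), of 3] by auto
  show ?thesis
  proof (cases "l < k")
    case True
    hence "real l + 1 \<le> real k" by linarith
    thus ?thesis using peano_x_in_third[OF l] by auto
  next
    case False
    hence "real k \<le> real l" by simp
    hence "u = real k / 3" using l assms by auto
    thus ?thesis using peano_x_third[OF assms(1)] by (simp only: order_refl)
  qed
qed

lemma peano_x_ge_third:
  assumes "k \<le> 3" "u \<in> {0..1}" "u \<ge> real k / 3"
  shows "peano_x u \<ge> real k / 3"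
proof -
  obtain l where l: "l < 3" "u \<in> {real l / 3..(real l + 1) / 3}"
    using unit_interval_cell[OF assms(2), of 3] by auto
  show ?thesis
  proof (cases "l \<ge> k")
    case True
    thus ?thesis using peano_x_in_third[OF l] by auto
  next
    case False
    hence "real l + 1 \<le> real k" by linarith
    hence "u = real k / 3" using l assms by auto
    thus ?thesis using peano_x_third[OF assms(1)] by (simp only: order_refl)
  qed
qed

text \<open>If \<open>u\<close> lies in the \<open>l\<close>-th third, the value at \<open>u\<close>
  is at most the right edge of column \<open>l\<close>, and later values never go below its left
  edge.\<close>

lemma peano_x_drawdown:
  assumes "0 \<le> u" "u \<le> v" "v \<le> 1"
  shows "peano_x u - peano_x v \<le> 1 / 3"
proof -
  obtain l where l: "l < 3" "u \<in> {real l / 3..(real l + 1) / 3}"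
    using unit_interval_cell[of u 3] assms by auto
  have "peano_x v \<ge> real l / 3"
    using l assms by (intro peano_x_ge_third) auto
  moreover have "peano_x u \<le> (real l + 1) / 3" using peano_x_in_third[OF l] by simp
  ultimately show ?thesis by (simp add: add_divide_distrib)
qed

text \<open>A second crossing would need a fall of at least \<open>c\<close>, more than
  \<open>peano_x_drawdown\<close> permits. So every interval strictly inside [0,1] is crossed
  exactly once; the two exceptional levels form a null set.\<close>

lemma mean_crossings_large:
  assumes "1 / 3 < c" "c \<le> 1"
  shows "mean_crossings c = 1 - c"
proof -
  have "real (crossings z c peano_x 0 1) = indicator {c / 2<..<1 - c / 2} z"
    if "z \<notin> {c / 2, 1 - c / 2}" for z
  proof (cases "z \<in> {c / 2<..<1 - c / 2}")
    case True
    have "crossings z c peano_x 0 1 = 1"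
    proof (rule crossings_eq_1[OF continuous_on_peano_x])
      fix u v :: real assume *: "0 \<le> u" "u \<le> v" "v \<le> 1" "z + c / 2 \<le> peano_x u" "peano_x v \<le> z - c / 2"
      thus False using peano_x_drawdown[OF *(1-3)] assms by linarith
    qed (use True assms in \<open>auto simp: peano_x_0 peano_x_1\<close>)
    thus ?thesis using True by simp
  next
    case False
    hence "crossings z c peano_x 0 1 = 0"
      using that assms by (intro crossings_peano_x_outside) auto
    thus ?thesis using False by simp
  qed
  hence "mean_crossings c = (LINT z|lborel. indicator {c / 2<..<1 - c / 2} z)"
    unfolding mean_crossings_def
    by (intro integral_discrete_difference[of "{c / 2, 1 - c / 2}"]) auto
  thus ?thesis using assms by simp
qed

text \<open>This locates the levels at which cutting the time at ninths could change the number of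
  crossings.\<close>

lemma peano_x_ninths:
  assumes "i < 9"
  shows "\<exists>k\<le>3. peano_x (real i / 9) = real k / 3"
proof -
  have d: "i div 3 \<le> 2" "i mod 3 \<le> 2" using assms by presburger+
  have "real i = 3 * real (i div 3) + real (i mod 3)"
    by (metis of_nat_add of_nat_mult of_nat_numeral mult_div_mod_eq)
  hence "peano_x (real i / 9) = real (i div 3 + (if even (i mod 3) then 0 else 1)) / 3"
    using peano_x_ninth[of 0 "i div 3" "i mod 3"] d by (simp add: peano_x_0)
  thus ?thesis using d(1) by (intro exI[of _ "i div 3 + (if even (i mod 3) then 0 else 1)"]) auto
qed

lemma mean_crossings_rec:
  assumes c: "0 < c" "c \<le> 1 / 3"
  shows "mean_crossings c = 3 * mean_crossings (3 * c) + 2 * c"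
proof -
  define piece where "piece i z = crossings z c peano_x (real i / 9) ((real i + 1) / 9)" for i z
  \<comment> \<open>The levels whose interval of length \<open>c\<close> has \<open>k / 3\<close> in
    its interior. The finite set \<open>X\<close> collects those where \<open>k / 3\<close> is an
    end of the interval and is discarded in the integral.\<close>
  define near where "near k = {real k / 3 - c / 2<..<real k / 3 + c / 2}" for k :: nat
  define X where "X = (\<lambda>k. real k / 3 - c / 2) ` {..3} \<union> (\<lambda>k. real k / 3 + c / 2) ` {..3}"
  have part: "(\<Sum>i\<le>8. piece i z) \<le> crossings z c peano_x 0 1"
    "(\<And>i. 1 \<le> i \<Longrightarrow> i \<le> 8 \<Longrightarrow> peano_x (real i / 9) \<notin> {z - c / 2..z + c / 2}) \<Longrightarrow>
      crossings z c peano_x 0 1 = (\<Sum>i\<le>8. piece i z)" for z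
    using crossings_partition(1,3)[of "\<lambda>i. real i / 9" 8 peano_x c z] continuous_on_peano_x c(1)
    by (simp_all add: mono_def piece_def add.commute)
  have near1: "crossings z c peano_x 0 1 = 1" "piece i z = 0" if k: "k \<in> {1,2}" "z \<in> near k" and i: "i \<le> 8" for k z i
  proof -
    show "crossings z c peano_x 0 1 = 1"
    proof (rule crossings_eq_1[OF continuous_on_peano_x c(1)])
      fix u v :: real assume *: "0 \<le> u" "u \<le> v" "v \<le> 1" "z + c / 2 \<le> peano_x u" "peano_x v \<le> z - c / 2"
      \<comment> \<open>The value at \<open>u\<close> exceeds \<open>k / 3\<close>, hence
        \<open>u\<close> is past the time \<open>k / 3\<close> and the curve cannot return below
        this level.\<close>
      have "real k / 3 < u"
        using peano_x_le_third[of k u] k * by (force simp: near_def)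
      hence "peano_x v \<ge> real k / 3"
        using k * by (intro peano_x_ge_third) auto
      thus False using k * by (auto simp: near_def)
    qed (use k c in \<open>auto simp: near_def peano_x_0 peano_x_1\<close>)
    \<comment> \<open>On a single ninth the curve stays weakly on one side of \<open>k / 3\<close>,
      an interior point of the interval to be crossed.\<close>
    show "piece i z = 0"
      unfolding piece_def
    proof (rule crossings_eq_0[OF continuous_on_peano_x_subinterval c(1)])
      have u01: "u \<in> {0..1}" if "u \<in> {real i / 9..(real i + 1) / 9}" for u
      proof -
        have "0 \<le> real i / 9" "(real i + 1) / 9 \<le> 1" using i by auto
        thus ?thesis using that by (meson atLeastAtMost_iff order_trans)
      qed
      show "(\<forall>u\<in>{real i / 9..(real i + 1) / 9}. peano_x u < z + c / 2) \<or>
        (\<forall>u\<in>{real i / 9..(real i + 1) / 9}. peano_x u > z - c / 2)"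
      proof (cases "i < 3 * k")
        case True
        hence "real i + 1 \<le> 3 * real k" by linarith
        hence "peano_x u \<le> real k / 3" if "u \<in> {real i / 9..(real i + 1) / 9}" for u
          using that u01[OF that] k by (intro peano_x_le_third) auto
        thus ?thesis using k(2) unfolding near_def by force
      next
        case False
        hence "real i \<ge> 3 * real k" by linarith
        hence "peano_x u \<ge> real k / 3" if "u \<in> {real i / 9..(real i + 1) / 9}" for u
          using that u01[OF that] k by (intro peano_x_ge_third) auto
        thus ?thesis using k(2) unfolding near_def by force
      qed
    qed (use i in auto)
  qed
  \<comment> \<open>Here \<open>c \<le> 1 / 3\<close> enters. The two disjoint bands of length
    \<open>c\<close> produce the term \<open>2 * c\<close>.\<close>
  have disj: "near 1 \<inter> near 2 = {}" using c unfolding near_def by auto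
  have "real (crossings z c peano_x 0 1) =
      (\<Sum>i\<le>8. real (piece i z)) + (indicator (near 1) z + indicator (near 2) z)" if "z \<notin> X" for z
  proof -
    \<comment> \<open>Near 0 or 1 the interval sticks out of [0,1], so there are no crossings on the
      whole, nor on any piece by superadditivity. Away from all four levels the pieces add up
      exactly.\<close>
    consider k where "k \<in> {1,2}" "z \<in> near k" | "z \<notin> near 1" "z \<notin> near 2" "z \<in> near 0 \<or> z \<in> near 3"
      | "\<And>k. k \<le> 3 \<Longrightarrow> z \<notin> near k"
    proof -
      have "k = 0 \<or> k = 1 \<or> k = 2 \<or> k = 3" if "k \<le> 3" for k :: nat using that by linarith
      thus ?thesis using that by blast
    qed
    thus ?thesis
    proof cases
      case 1
      have "indicator (near 1) z + indicator (near 2) z = (1::real)"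
        using 1 disj by (auto simp: indicator_def)
      thus ?thesis using near1[OF 1] near1(1)[OF 1, of 0] by simp
    next
      case 2
      have "crossings z c peano_x 0 1 = 0"
        using 2(3) c by (intro crossings_peano_x_outside) (auto simp: near_def)
      thus ?thesis using part(1)[of z] 2(1,2) by simp
    next
      case 3
      have "real k / 3 \<notin> {z - c / 2..z + c / 2}" if "k \<le> 3" for k
      proof -
        have "z \<noteq> real k / 3 - c / 2" "z \<noteq> real k / 3 + c / 2"
          using \<open>z \<notin> X\<close> that unfolding X_def by auto
        thus ?thesis using 3[OF that] unfolding near_def by auto
      qed
      hence "peano_x (real i / 9) \<notin> {z - c / 2..z + c / 2}" if "i \<le> 8" for i
      proof -
        obtain k where "k \<le> 3" "peano_x (real i / 9) = real k / 3"
          using peano_x_ninths[of i] \<open>i \<le> 8\<close> by force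
        thus ?thesis using \<open>\<And>k. k \<le> 3 \<Longrightarrow> real k / 3 \<notin> {z - c / 2..z + c / 2}\<close> by metis
      qed
      hence "crossings z c peano_x 0 1 = (\<Sum>i\<le>8. piece i z)" by (intro part(2)) auto
      thus ?thesis using 3[of 1] 3[of 2] by simp
    qed
  qed
  hence "mean_crossings c =
      (LINT z|lborel. (\<Sum>i\<le>8. real (piece i z)) + (indicator (near 1) z + indicator (near 2) z))"
    unfolding mean_crossings_def
    by (intro integral_discrete_difference[of X]) (auto simp: X_def intro: countable_finite)
  also have "\<dots> = (\<Sum>i\<le>8. LINT z|lborel. real (piece i z)) + (c + c)"
  proof -
    have p: "integrable lborel (\<lambda>z. real (piece i z))" if "i \<in> {..8}" for i
      unfolding piece_def using that c by (intro crossings_peano_x_integrable') auto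
    have n: "integrable lborel (indicator (near k) :: real \<Rightarrow> real)"
      "(LINT z|lborel. indicator (near k) z) = c" for k
      using c by (auto simp: near_def)
    show ?thesis
      using p n by (subst Bochner_Integration.integral_add) (auto simp: Bochner_Integration.integral_sum)
  qed
  \<comment> \<open>Nine pieces, each contributing a third of the mean at scale
    \<open>3 * c\<close>, give the factor 3.\<close>
  also have "(\<Sum>i\<le>8. LINT z|lborel. real (piece i z)) = (\<Sum>i\<le>(8::nat). mean_crossings (3 * c) / 3)"
    using mean_crossings_cell[of _ 1 c] c(1) by (intro sum.cong) (auto simp: piece_def)
  finally show ?thesis by simp
qed

text \<open>The inhomogeneous recursion has the particular solution \<open>- y / 4 / 3 ^ k\<close>,
  and the start value \<open>1 - y\<close> fixes the coefficient \<open>1 - 3 / 4 * y\<close> of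
  \<open>3 ^ k\<close>. This coefficient is the one that \<open>peano_phi\<close> divides
  by.\<close>

lemma mean_crossings_eq:
  assumes "1 / 3 < y" "y \<le> 1"
  shows "mean_crossings (y / 3 ^ k) = 3 ^ k * (1 - 3 / 4 * y - y / 4 / 9 ^ k)"
proof (induction k)
  case 0
  show ?case using mean_crossings_large[OF assms] by simp
next
  case (Suc k)
  have "y / 3 ^ Suc k \<le> 1 / 3"
  proof -
    have "(1::real) \<le> 3 ^ k" by simp
    hence "y \<le> 3 ^ k" using assms(2) by linarith
    thus ?thesis by (simp add: field_simps)
  qed
  hence "mean_crossings (y / 3 ^ Suc k) = 3 * mean_crossings (y / 3 ^ k) + 2 * (y / 3 ^ Suc k)"
    using mean_crossings_rec[of "y / 3 ^ Suc k"] assms by simp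
  moreover have "(9::real) ^ k = 3 ^ k * 3 ^ k" by (simp flip: power_mult_distrib)
  ultimately show ?case unfolding Suc.IH by (simp add: field_simps)
qed

section \<open>The normalising function at ternary scales\<close>

lemma peano_phi_eq:
  assumes "1 / 3 < y" "y \<le> 1"
  shows "peano_phi (y / 3 ^ k) = 1 / (3 ^ k * (1 - 3 / 4 * y))"
proof -
  have "log 3 (y / 3 ^ k) = log 3 y - real k"
    using assms by (simp add: log_divide log_nat_power)
  moreover have "-1 < log 3 y" "log 3 y \<le> 0"
    using assms by (auto simp: less_log_iff powr_minus_divide)
  ultimately have "\<lfloor>- log 3 (y / 3 ^ k)\<rfloor> = int k"
    by (intro floor_unique) auto
  thus ?thesis unfolding peano_phi_def by simp
qed

text \<open>The mantissa \<open>y\<close> is taken from the range in which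
  \<open>mean_crossings_large\<close> starts the recursion.\<close>

lemma ternary_scale:
  assumes "0 < c" "c \<le> 1"
  obtains k :: nat and y :: real where "1 / 3 < y" "y \<le> 1" "c = y / 3 ^ k"
proof -
  define k where "k = nat \<lfloor>- log 3 c\<rfloor>"
  have "log 3 c \<le> 0" using assms by simp
  hence k: "real k \<le> - log 3 c" "- log 3 c < real k + 1"
    unfolding k_def by (auto simp: of_nat_nat)
  have "log 3 (c * 3 ^ k) = log 3 c + real k"
    using assms by (simp add: log_mult log_nat_power)
  hence "-1 < log 3 (c * 3 ^ k)" "log 3 (c * 3 ^ k) \<le> 0" using k by auto
  hence "1 / 3 < c * 3 ^ k" "c * 3 ^ k \<le> 1"
    using assms by (auto simp: less_log_iff powr_minus_divide)
  thus ?thesis using that[of "c * 3 ^ k" k] by simp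
qed

lemma peano_phi_scale:
  assumes "0 < c" "c \<le> 1"
  shows "peano_phi (c / 3 ^ m) = peano_phi c / 3 ^ m"
proof -
  obtain k y where ky: "1 / 3 < y" "y \<le> 1" "c = y / 3 ^ k" using ternary_scale[OF assms] .
  have eq: "c / 3 ^ m = y / 3 ^ (k + m)" by (simp add: ky(3) power_add)
  have "peano_phi c = 1 / (3 ^ k * (1 - 3 / 4 * y))" using peano_phi_eq[OF ky(1,2)] ky(3) by simp
  thus ?thesis unfolding eq peano_phi_eq[OF ky(1,2)] by (simp add: power_add)
qed

text \<open>With \<open>c = y / 3 ^ k\<close> and \<open>r = 1 - 3 / 4 * y\<close>, the weighted
  mean is exactly \<open>1 - y / (4 * r) / 9 ^ k\<close>; everything follows from
  \<open>y > 1 / 3\<close> and \<open>r \<ge> 1 / 4\<close>.\<close>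

lemma peano_phi_bounds:
  assumes "0 < c" "c \<le> 1"
  shows "0 \<le> peano_phi c" "peano_phi c \<le> 12 * c"
    "peano_phi c * mean_crossings c \<le> 1" "1 - 9 * c\<^sup>2 \<le> peano_phi c * mean_crossings c"
proof -
  obtain k y where ky: "1 / 3 < y" "y \<le> 1" "c = y / 3 ^ k" using ternary_scale[OF assms] .
  define r where "r = 1 - 3 / 4 * y"
  have r: "1 / 4 \<le> r" "r > 0" using ky by (auto simp: r_def)
  have phi: "peano_phi c = 1 / (3 ^ k * r)" using peano_phi_eq[OF ky(1,2)] ky(3) by (simp add: r_def)
  show "0 \<le> peano_phi c" using r unfolding phi by simp
  \<comment> \<open>Both \<open>3 * y\<close> and \<open>4 * r\<close> are at least 1; their
    constants multiply to the 12 in the bound.\<close>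
  have "1 \<le> 3 * y * (4 * r)" using mult_mono[of 1 "3 * y" 1 "4 * r"] ky r by simp
  hence "1 / r \<le> 12 * y" using r by (simp add: field_simps)
  hence "1 / r / 3 ^ k \<le> 12 * y / 3 ^ k" by (rule divide_right_mono) simp
  thus "peano_phi c \<le> 12 * c" unfolding phi unfolding ky(3) by (simp add: mult.commute)
  have "peano_phi c * mean_crossings c = (r - y / 4 / 9 ^ k) / r"
    unfolding phi unfolding ky(3) mean_crossings_eq[OF ky(1,2)] r_def by simp
  also have "\<dots> = 1 - y / (4 * r) / 9 ^ k" using r by (simp add: field_simps)
  finally have eq: "peano_phi c * mean_crossings c = 1 - y / (4 * r) / 9 ^ k" .
  show "peano_phi c * mean_crossings c \<le> 1" unfolding eq using ky r by simp
  have "y / (4 * r) \<le> 9 * y\<^sup>2"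
  proof -
    have "1 * 1 \<le> (4 * r) * (9 * y)" using ky r by (intro mult_mono) auto
    hence "y * 1 \<le> y * ((4 * r) * (9 * y))" using ky by (intro mult_left_mono) auto
    thus ?thesis using r by (simp add: field_simps power2_eq_square)
  qed
  hence "y / (4 * r) / 9 ^ k \<le> 9 * y\<^sup>2 / 9 ^ k" by (rule divide_right_mono) simp
  also have "\<dots> = 9 * c\<^sup>2" unfolding ky(3) by (simp add: power_divide power2_eq_square flip: power_mult_distrib)
  finally show "1 - 9 * c\<^sup>2 \<le> peano_phi c * mean_crossings c" unfolding eq by simp
qed

lemma tendsto_peano_phi: "(peano_phi \<longlongrightarrow> 0) (at_right 0)"
proof (rule tendsto_sandwich[of "\<lambda>_. 0" _ _ "\<lambda>c. 12 * c"])
  have ev: "\<forall>\<^sub>F c in at_right (0::real). 0 < c \<and> c \<le> 1"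
    unfolding eventually_at_right_field by (intro exI[of _ 1]) auto
  show "\<forall>\<^sub>F c in at_right 0. 0 \<le> peano_phi c" "\<forall>\<^sub>F c in at_right 0. peano_phi c \<le> 12 * c"
    using ev by (eventually_elim, simp add: peano_phi_bounds)+
  show "((\<lambda>c::real. 12 * c) \<longlongrightarrow> 0) (at_right 0)" by (auto intro!: tendsto_eq_intros)
qed auto

section \<open>Convergence to the local time\<close>

lemma continuous_on_unit_interval_bounded:
  fixes g :: "real \<Rightarrow> real"
  assumes "continuous_on {0..1} g"
  obtains G where "\<And>z. z \<in> {0..1} \<Longrightarrow> \<bar>g z\<bar> \<le> G"
proof -
  have "bounded (g ` {0..1})"
    using assms by (intro compact_imp_bounded compact_continuous_image) auto
  then obtain G where "\<forall>z\<in>{0..1}. \<bar>g z\<bar> \<le> G" by (auto simp: bounded_iff)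
  thus ?thesis using that by blast
qed

lemma cell_bounds:
  assumes "i < 9 ^ m"
  shows "0 \<le> real i / 9 ^ m" "real i / 9 ^ m \<le> (real i + 1) / 9 ^ m" "(real i + 1) / 9 ^ m \<le> 1"
proof -
  have "real i + 1 = real (Suc i)" by simp
  also have "\<dots> \<le> real (9 ^ m)" using assms by (intro of_nat_mono) simp
  finally show "(real i + 1) / 9 ^ m \<le> 1" by simp
qed (auto simp: divide_right_mono)

text \<open>A crossing forces the curve to take values on both sides of \<open>z\<close> within the
  cell, so \<open>z\<close> lies in the column of the cell.\<close>

lemma crossings_peano_x_cell_nonzero:
  assumes i: "i < 9 ^ m" and c: "c > 0"
    and nz: "crossings z c peano_x (real i / 9 ^ m) ((real i + 1) / 9 ^ m) \<noteq> 0"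
  shows "z \<in> {0..1}" "\<bar>z - peano_x (real i / 9 ^ m)\<bar> \<le> 1 / 3 ^ m"
proof -
  let ?l = "real i / 9 ^ m" and ?r = "(real i + 1) / 9 ^ m"
  note b = cell_bounds[OF i]
  have l: "?l \<in> {?l..?r}" using b by simp
  obtain u v where uv: "u \<in> {?l..?r}" "peano_x u \<ge> z + c / 2" "v \<in> {?l..?r}" "peano_x v \<le> z - c / 2"
    using crossings_eq_0[OF continuous_on_peano_x_subinterval[OF b(1,3)] c b(2), of z] nz
    by (meson not_le)
  have "w \<in> {0..1}" if "w \<in> {?l..?r}" for w
    using that b by (meson atLeastAtMost_iff order_trans)
  hence "peano_x u \<in> {0..1}" "peano_x v \<in> {0..1}"
    using uv(1,3) by (blast intro: peano_x_bounds)+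
  thus "z \<in> {0..1}" using uv c by auto
  show "\<bar>z - peano_x ?l\<bar> \<le> 1 / 3 ^ m"
    using peano_x_cell_oscillation[OF i uv(1) l] peano_x_cell_oscillation[OF i uv(3) l] uv(2,4) c
    by (auto simp: abs_le_iff)
qed

text \<open>In both integrals \<open>g\<close> is replaced by its value \<open>h\<close> at the left
  end of the cell, each time at cost \<open>\<omega> / 9 ^ m\<close>. What remains is the deviation
  of the weighted mass \<open>M\<close> from 1.\<close>

lemma cell_estimate:
  assumes i: "i < 9 ^ m" and c: "0 < c" "c \<le> 1 / 3 ^ m" and g: "continuous_on UNIV g"
    and G: "\<And>z. z \<in> {0..1} \<Longrightarrow> \<bar>g z\<bar> \<le> (G::real)"
    and \<omega>: "\<And>z z'. z \<in> {0..1} \<Longrightarrow> z' \<in> {0..1} \<Longrightarrow> \<bar>z - z'\<bar> \<le> 1 / 3 ^ m \<Longrightarrow> \<bar>g z - g z'\<bar> \<le> \<omega>"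
  shows "\<bar>peano_phi c * (LINT z|lborel. real (crossings z c peano_x (real i / 9 ^ m) ((real i + 1) / 9 ^ m)) * g z)
      - integral {real i / 9 ^ m..(real i + 1) / 9 ^ m} (\<lambda>s. g (peano_x s))\<bar>
    \<le> (2 * \<omega> + 9 * G * (3 ^ m * c)\<^sup>2) / 9 ^ m"
proof -
  let ?l = "real i / 9 ^ m" and ?r = "(real i + 1) / 9 ^ m"
  define n where "n z = real (crossings z c peano_x ?l ?r)" for z
  define h where "h = g (peano_x ?l)"
  define M where "M = peano_phi (3 ^ m * c) * mean_crossings (3 ^ m * c)"
  note b = cell_bounds[OF i]
  have x_l: "peano_x ?l \<in> {0..1}"
    using b(1) order_trans[OF b(2,3)] by (intro peano_x_bounds) (simp only: atLeastAtMost_iff)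
  have h: "\<bar>h\<bar> \<le> G" unfolding h_def using G x_l by blast
  have \<omega>0: "0 \<le> \<omega>" using \<omega>[of 0 0] by simp
  have gm: "g \<in> borel_measurable borel" using g by (rule borel_measurable_continuous_onI)
  have c': "0 < 3 ^ m * c" "3 ^ m * c \<le> 1" using c by (auto simp: field_simps)
  have phi: "peano_phi c = peano_phi (3 ^ m * c) / 3 ^ m"
    using peano_phi_scale[OF c', of m] by simp
  have phi0: "0 \<le> peano_phi c" using peano_phi_bounds(1)[OF c'] phi by simp
  have n_int: "integrable lborel n"
    unfolding n_def using crossings_peano_x_integrable'[OF c(1) b] .
  have ng_int: "integrable lborel (\<lambda>z. n z * g z)"
    unfolding n_def using crossings_peano_x_integrable[OF c(1) b gm G] .
  have "(9::real) ^ m = 3 ^ m * 3 ^ m" by (simp flip: power_mult_distrib)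
  \<comment> \<open>The scaling of \<open>peano_phi\<close> and the scaling of the mean each
    contribute \<open>1 / 3 ^ m\<close>.\<close>
  hence nM: "peano_phi c * (LINT z|lborel. n z) = M / 9 ^ m"
    unfolding n_def mean_crossings_cell[OF i c(1)] phi M_def by simp
  have M: "M \<le> 1" "1 - 9 * (3 ^ m * c)\<^sup>2 \<le> M"
    unfolding M_def using peano_phi_bounds(3,4)[OF c'] by auto
  \<comment> \<open>The crossing number vanishes off the column of the cell, and on the column
    \<open>g\<close> differs from \<open>h\<close> by at most \<open>\<omega>\<close>.\<close>
  have 1: "\<bar>peano_phi c * (LINT z|lborel. n z * g z) - h * M / 9 ^ m\<bar> \<le> \<omega> / 9 ^ m"
  proof -
    have "(LINT z|lborel. n z * g z) - h * (LINT z|lborel. n z) = (LINT z|lborel. n z * g z - h * n z)"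
      using n_int ng_int by simp
    also have "\<bar>\<dots>\<bar> \<le> (LINT z|lborel. \<bar>n z * g z - h * n z\<bar>)" by (rule integral_abs_bound)
    also have "\<dots> \<le> (LINT z|lborel. n z * \<omega>)"
    proof (rule Bochner_Integration.integral_mono)
      show "\<bar>n z * g z - h * n z\<bar> \<le> n z * \<omega>" for z
      proof (cases "n z = 0")
        case False
        hence "\<bar>g z - h\<bar> \<le> \<omega>"
          using crossings_peano_x_cell_nonzero[OF i c(1), of z] x_l unfolding n_def h_def
          by (intro \<omega>) auto
        hence "n z * \<bar>g z - h\<bar> \<le> n z * \<omega>" by (intro mult_left_mono) (auto simp: n_def)
        moreover have "n z * g z - h * n z = n z * (g z - h)" by (simp add: algebra_simps)
        ultimately show ?thesis by (simp add: abs_mult n_def)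
      qed simp
    qed (use n_int ng_int in auto)
    finally have "\<bar>(LINT z|lborel. n z * g z) - h * (LINT z|lborel. n z)\<bar> \<le> \<omega> * (LINT z|lborel. n z)"
      by (simp add: mult.commute)
    hence "peano_phi c * \<bar>(LINT z|lborel. n z * g z) - h * (LINT z|lborel. n z)\<bar>
        \<le> peano_phi c * (\<omega> * (LINT z|lborel. n z))"
      using phi0 by (rule mult_left_mono)
    also have "\<dots> = \<omega> * (M / 9 ^ m)" unfolding nM[symmetric] by simp
    also have "\<dots> \<le> \<omega> * (1 / 9 ^ m)"
      using M \<omega>0 by (intro mult_left_mono divide_right_mono) auto
    finally have "\<bar>peano_phi c * ((LINT z|lborel. n z * g z) - h * (LINT z|lborel. n z))\<bar> \<le> \<omega> / 9 ^ m"
      using phi0 by (simp add: abs_mult)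
    moreover have "peano_phi c * ((LINT z|lborel. n z * g z) - h * (LINT z|lborel. n z)) =
        peano_phi c * (LINT z|lborel. n z * g z) - h * M / 9 ^ m"
      using nM by (simp add: right_diff_distrib mult.left_commute[of _ h])
    ultimately show ?thesis by simp
  qed
  have 2: "\<bar>h * M / 9 ^ m - h / 9 ^ m\<bar> \<le> 9 * G * (3 ^ m * c)\<^sup>2 / 9 ^ m"
  proof -
    have "\<bar>h * (M - 1)\<bar> \<le> G * (9 * (3 ^ m * c)\<^sup>2)"
      unfolding abs_mult using h M by (intro mult_mono) auto
    hence "\<bar>h * (M - 1)\<bar> / 9 ^ m \<le> G * (9 * (3 ^ m * c)\<^sup>2) / 9 ^ m" by (rule divide_right_mono) simp
    moreover have "h * M / 9 ^ m - h / 9 ^ m = h * (M - 1) / 9 ^ m"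
      by (simp add: right_diff_distrib diff_divide_distrib)
    ultimately show ?thesis by (simp add: mult_ac)
  qed
  have 3: "\<bar>integral {?l..?r} (\<lambda>s. g (peano_x s)) - h / 9 ^ m\<bar> \<le> \<omega> / 9 ^ m"
  proof -
    have cont: "continuous_on {?l..?r} (\<lambda>s. g (peano_x s))"
      using continuous_on_compose2[OF g continuous_on_peano_x_subinterval[OF b(1,3)]] by auto
    have bd: "norm (g (peano_x s) - h) \<le> \<omega>" if "s \<in> {?l..?r}" for s
    proof -
      have "s \<in> {0..1}" using that b by (meson atLeastAtMost_iff order_trans)
      hence "peano_x s \<in> {0..1}" by (rule peano_x_bounds)
      moreover have "\<bar>peano_x s - peano_x ?l\<bar> \<le> 1 / 3 ^ m"
        using b(2) by (intro peano_x_cell_oscillation[OF i that]) auto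
      ultimately show ?thesis unfolding h_def real_norm_def using x_l by (intro \<omega>) auto
    qed
    have len: "?r - ?l = 1 / 9 ^ m" by (simp add: add_divide_distrib)
    have "norm (integral {?l..?r} (\<lambda>s. g (peano_x s) - h)) \<le> \<omega> * (?r - ?l)"
      using b(2) cont bd by (intro integral_bound continuous_intros) auto
    moreover have "integral {?l..?r} (\<lambda>s. g (peano_x s) - h) =
        integral {?l..?r} (\<lambda>s. g (peano_x s)) - h * (?r - ?l)"
      using b(2) by (subst Henstock_Kurzweil_Integration.integral_diff)
        (auto intro: integrable_continuous_real cont)
    ultimately show ?thesis unfolding len by simp
  qed
  have "\<bar>peano_phi c * (LINT z|lborel. n z * g z) - integral {?l..?r} (\<lambda>s. g (peano_x s))\<bar> \<le>
    \<omega> / 9 ^ m + 9 * G * (3 ^ m * c)\<^sup>2 / 9 ^ m + \<omega> / 9 ^ m"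
  proof -
    have "\<bar>p - s\<bar> \<le> e1 + e2 + e3" if "\<bar>p - q\<bar> \<le> e1" "\<bar>q - r\<bar> \<le> e2" "\<bar>s - r\<bar> \<le> e3"
      for p q r s e1 e2 e3 :: real
      using that by linarith
    from this[OF 1 2 3] show ?thesis .
  qed
  also have "\<dots> = (2 * \<omega> + 9 * G * (3 ^ m * c)\<^sup>2) / 9 ^ m" by (simp add: add_divide_distrib)
  finally show ?thesis unfolding n_def .
qed

lemma integral_cells:
  fixes f :: "real \<Rightarrow> real"
  assumes f: "continuous_on {0..1} f" and "K \<le> 9 ^ m"
  shows "integral {0..real K / 9 ^ m} f = (\<Sum>i<K. integral {real i / 9 ^ m..(real i + 1) / 9 ^ m} f)"
  using assms(2)
proof (induction K)
  case (Suc K)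
  note b = cell_bounds[of K m]
  have "f integrable_on {0..(real K + 1) / 9 ^ m}"
    using b Suc.prems by (intro integrable_continuous_real continuous_on_subset[OF f]) auto
  hence "integral {0..real K / 9 ^ m} f + integral {real K / 9 ^ m..(real K + 1) / 9 ^ m} f =
      integral {0..(real K + 1) / 9 ^ m} f"
    using b Suc.prems by (intro Henstock_Kurzweil_Integration.integral_combine) auto
  thus ?case using Suc by (simp add: add.commute)
qed simp

text \<open>The first two terms come from at most \<open>9 ^ m\<close> full cells and
  \<open>2 * G / 9 ^ m\<close> from the last partial cell in both integrals. The last term is the
  loss of up to two crossings at each cell boundary, weighted by
  \<open>peano_phi c \<le> 12 * c\<close>.\<close>

lemma crossing_integral_estimate:
  assumes t: "t \<in> {0..1}" and c: "0 < c" "c \<le> 1 / 3 ^ m" and g: "continuous_on UNIV g"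
    and G: "\<And>z. z \<in> {0..1} \<Longrightarrow> \<bar>g z\<bar> \<le> (G::real)"
    and \<omega>: "\<And>z z'. z \<in> {0..1} \<Longrightarrow> z' \<in> {0..1} \<Longrightarrow> \<bar>z - z'\<bar> \<le> 1 / 3 ^ m \<Longrightarrow> \<bar>g z - g z'\<bar> \<le> \<omega>"
  shows "\<bar>peano_phi c * (LINT z|lborel. real (crossings z c peano_x 0 t) * g z)
      - integral {0..t} (\<lambda>s. g (peano_x s))\<bar>
    \<le> 2 * \<omega> + 9 * G * (3 ^ m * c)\<^sup>2 + 2 * G / 9 ^ m + 24 * 9 ^ m * G * c"
proof -
  obtain K where K: "K < 9 ^ m" "t \<in> {real K / 9 ^ m..(real K + 1) / 9 ^ m}"
    using unit_interval_cell[OF t, of "9 ^ m"] by auto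
  define l where "l = real K / 9 ^ m"
  have l: "0 \<le> l" "l \<le> t" "t \<le> 1" using K t by (auto simp: l_def)
  define n where "n i z = real (crossings z c peano_x (real i / 9 ^ m) ((real i + 1) / 9 ^ m))" for i z
  define r where "r z = real (crossings z c peano_x l t)" for z
  define N where "N z = real (crossings z c peano_x 0 t)" for z
  \<comment> \<open>The crossings lost by cutting at the cell boundaries.\<close>
  define e where "e z = N z - ((\<Sum>i<K. n i z) + r z)" for z
  have gm: "g \<in> borel_measurable borel" using g by (rule borel_measurable_continuous_onI)
  have G0: "0 \<le> G" using G[of 0] by simp
  have "(1::real) \<le> 3 ^ m" by simp
  hence "1 / 3 ^ m \<le> (1::real)" by simp
  hence c1: "c \<le> 1" using c(2) by linarith
  note phi = peano_phi_bounds(1,2)[OF c(1) c1]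
  have i: "i < 9 ^ m" if "i < K" for i using that K by simp
  have n_int: "integrable lborel (\<lambda>z. n i z * g z)" if "i < 9 ^ m" for i
    unfolding n_def using crossings_peano_x_integrable[OF c(1) cell_bounds[OF that] gm G] .
  have r_int: "integrable lborel (\<lambda>z. r z * g z)"
    unfolding r_def using crossings_peano_x_integrable[OF c(1) l gm G] .
  have N_int: "integrable lborel (\<lambda>z. N z * g z)"
    unfolding N_def using t crossings_peano_x_integrable[OF c(1) _ _ _ gm G] by auto
  have e_bound: "0 \<le> e z \<and> e z \<le> 2 * real K" for z
  proof -
    \<comment> \<open>Truncating the grid at \<open>t\<close> makes the last piece the partial cell
      \<open>{l..t}\<close> and leaves \<open>K\<close> interior points.\<close>
    define p where "p i = min (real i / 9 ^ m) t" for i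
    have "mono p" unfolding p_def by (intro monoI min.mono divide_right_mono) auto
    have p_small: "p i = real i / 9 ^ m" if "i \<le> K" for i
    proof -
      have "real i / 9 ^ m \<le> l" using that by (simp add: l_def divide_right_mono)
      thus ?thesis using l unfolding p_def by auto
    qed
    have p_last: "p (Suc K) = t" using K(2) by (simp add: p_def add.commute)
    have "p 0 = 0" using l by (simp add: p_def)
    have sum: "(\<Sum>i\<le>K. real (crossings z c peano_x (p i) (p (Suc i)))) = (\<Sum>i<K. n i z) + r z"
    proof -
      have "(\<Sum>i\<le>K. real (crossings z c peano_x (p i) (p (Suc i)))) =
        (\<Sum>i<K. real (crossings z c peano_x (p i) (p (Suc i)))) + real (crossings z c peano_x (p K) (p (Suc K)))"
        by (simp add: lessThan_Suc_atMost[symmetric])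
      also have "(\<Sum>i<K. real (crossings z c peano_x (p i) (p (Suc i)))) = (\<Sum>i<K. n i z)"
        unfolding n_def by (intro sum.cong) (auto simp: p_small add.commute)
      also have "real (crossings z c peano_x (p K) (p (Suc K))) = r z"
        unfolding r_def p_last by (simp add: p_small l_def)
      finally show ?thesis .
    qed
    have cont: "continuous_on {p 0..p (Suc K)} peano_x"
      unfolding p_last \<open>p 0 = 0\<close> using l by (intro continuous_on_peano_x_subinterval) auto
    from of_nat_mono[where 'a = real, OF crossings_partition(1)[OF \<open>mono p\<close> cont c(1), of z]]
      of_nat_mono[where 'a = real, OF crossings_partition(2)[OF \<open>mono p\<close> cont c(1), of z]]
    show ?thesis unfolding e_def N_def p_last \<open>p 0 = 0\<close> by (simp add: sum)
  qed
  have e_eq: "(LINT z|lborel. N z * g z) =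
      (\<Sum>i<K. LINT z|lborel. n i z * g z) + (LINT z|lborel. r z * g z) + (LINT z|lborel. e z * g z)"
    and e_int: "integrable lborel (\<lambda>z. e z * g z)"
  proof -
    have eg: "e z * g z = N z * g z - ((\<Sum>i<K. n i z * g z) + r z * g z)" for z
      by (simp add: e_def left_diff_distrib distrib_right sum_distrib_right)
    have s_int: "integrable lborel (\<lambda>z. (\<Sum>i<K. n i z * g z))"
      using n_int i by (intro Bochner_Integration.integrable_sum) auto
    show "integrable lborel (\<lambda>z. e z * g z)"
      unfolding eg using N_int s_int r_int by auto
    have "(LINT z|lborel. e z * g z) =
      (LINT z|lborel. N z * g z) - ((LINT z|lborel. (\<Sum>i<K. n i z * g z)) + (LINT z|lborel. r z * g z))"
      unfolding eg using N_int s_int r_int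
      by (simp add: Bochner_Integration.integral_diff Bochner_Integration.integral_add)
    also have "(LINT z|lborel. (\<Sum>i<K. n i z * g z)) = (\<Sum>i<K. LINT z|lborel. n i z * g z)"
      using n_int i by (intro Bochner_Integration.integral_sum) auto
    finally show "(LINT z|lborel. N z * g z) =
      (\<Sum>i<K. LINT z|lborel. n i z * g z) + (LINT z|lborel. r z * g z) + (LINT z|lborel. e z * g z)"
      by simp
  qed
  have "\<bar>LINT z|lborel. e z * g z\<bar> \<le> 2 * real K * G"
  proof (rule integral_bounded_unit_interval[OF e_int])
    show "\<bar>e z * g z\<bar> \<le> 2 * real K * G" if "z \<in> {0..1}" for z
      unfolding abs_mult using e_bound[of z] G[OF that] by (intro mult_mono) auto
    show "e z * g z = 0" if z: "z \<notin> {0..1}" for z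
    proof -
      have "N z = 0"
        unfolding N_def using z c(1) t by (auto intro!: crossings_peano_x_outside)
      moreover have "0 \<le> (\<Sum>i<K. n i z) + r z" unfolding n_def r_def by (simp add: sum_nonneg)
      ultimately have "e z = 0" using e_bound[of z] unfolding e_def by linarith
      thus ?thesis by simp
    qed
  qed
  hence "\<bar>peano_phi c * (LINT z|lborel. e z * g z)\<bar> \<le> (12 * c) * (2 * real K * G)"
    unfolding abs_mult using phi by (intro mult_mono) auto
  also have "\<dots> = 24 * real K * G * c" by simp
  also have "\<dots> \<le> 24 * 9 ^ m * G * c"
  proof -
    have "real K \<le> real (9 ^ m)" using K(1) by (intro of_nat_mono) simp
    thus ?thesis using G0 c(1) by (intro mult_right_mono) auto
  qed
  finally have E: "\<bar>peano_phi c * (LINT z|lborel. e z * g z)\<bar> \<le> 24 * 9 ^ m * G * c" .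
  \<comment> \<open>By superadditivity the partial cell has no more crossings than the whole cell
    \<open>K\<close>, whose weighted mass is at most \<open>1 / 9 ^ m\<close>.\<close>
  have R: "\<bar>peano_phi c * (LINT z|lborel. r z * g z)\<bar> \<le> G / 9 ^ m"
  proof -
    have "\<bar>LINT z|lborel. r z * g z\<bar> \<le> (LINT z|lborel. \<bar>r z * g z\<bar>)" by (rule integral_abs_bound)
    also have "\<dots> \<le> (LINT z|lborel. G * n K z)"
    proof (rule Bochner_Integration.integral_mono)
      show "integrable lborel (\<lambda>z. G * n K z)"
        unfolding n_def using crossings_peano_x_integrable'[OF c(1) cell_bounds[OF K(1)]] by simp
      show "\<bar>r z * g z\<bar> \<le> G * n K z" for z
      proof (cases "z \<in> {0..1}")
        case True
        have "r z \<le> n K z"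
          unfolding r_def n_def l_def of_nat_le_iff
          using crossings_superadd[OF continuous_on_peano_x_subinterval c(1), of "real K / 9 ^ m" "(real K + 1) / 9 ^ m" t z]
            cell_bounds[OF K(1)] K(2) by auto
        hence "r z * \<bar>g z\<bar> \<le> n K z * G"
          using G[OF True] by (intro mult_mono) (auto simp: r_def n_def)
        thus ?thesis by (simp add: abs_mult r_def mult.commute)
      next
        case False
        hence "r z = 0"
          unfolding r_def using c(1) l by (auto intro!: crossings_peano_x_outside)
        thus ?thesis using G0 by (simp add: n_def)
      qed
    qed (use r_int in auto)
    finally have "peano_phi c * \<bar>LINT z|lborel. r z * g z\<bar> \<le> peano_phi c * (LINT z|lborel. G * n K z)"
      using phi(1) by (intro mult_left_mono)
    also have "\<dots> = G * (peano_phi (3 ^ m * c) * mean_crossings (3 ^ m * c) / 9 ^ m)"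
    proof -
      have c': "0 < 3 ^ m * c" "3 ^ m * c \<le> 1" using c by (auto simp: field_simps)
      have "(9::real) ^ m = 3 ^ m * 3 ^ m" by (simp flip: power_mult_distrib)
      thus ?thesis
        using mean_crossings_cell[OF K(1) c(1)] peano_phi_scale[OF c', of m] by (simp add: n_def)
    qed
    also have "\<dots> \<le> G * (1 / 9 ^ m)"
    proof -
      have c': "0 < 3 ^ m * c" "3 ^ m * c \<le> 1" using c by (auto simp: field_simps)
      show ?thesis using G0 peano_phi_bounds(3)[OF c'] by (intro mult_left_mono divide_right_mono) auto
    qed
    finally show ?thesis using phi(1) by (simp add: abs_mult)
  qed
  have gx: "continuous_on {0..1} (\<lambda>s. g (peano_x s))"
    using continuous_on_compose2[OF g continuous_on_peano_x] by auto
  have "integral {0..l} (\<lambda>s. g (peano_x s)) + integral {l..t} (\<lambda>s. g (peano_x s)) =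
      integral {0..t} (\<lambda>s. g (peano_x s))"
    using l by (intro Henstock_Kurzweil_Integration.integral_combine integrable_continuous_real
        continuous_on_subset[OF gx]) auto
  moreover have "integral {0..l} (\<lambda>s. g (peano_x s)) =
      (\<Sum>i<K. integral {real i / 9 ^ m..(real i + 1) / 9 ^ m} (\<lambda>s. g (peano_x s)))"
    unfolding l_def using K(1) by (intro integral_cells[OF gx]) simp
  ultimately have I: "integral {0..t} (\<lambda>s. g (peano_x s)) =
      (\<Sum>i<K. integral {real i / 9 ^ m..(real i + 1) / 9 ^ m} (\<lambda>s. g (peano_x s))) +
      integral {l..t} (\<lambda>s. g (peano_x s))" by simp
  have T: "\<bar>integral {l..t} (\<lambda>s. g (peano_x s))\<bar> \<le> G / 9 ^ m"
  proof -
    have "norm (integral {l..t} (\<lambda>s. g (peano_x s))) \<le> G * (t - l)"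
      using l G peano_x_bounds by (intro integral_bound continuous_on_subset[OF gx]) auto
    also have "t - l \<le> 1 / 9 ^ m" using K(2) by (simp add: l_def add_divide_distrib)
    hence "G * (t - l) \<le> G * (1 / 9 ^ m)" using G0 by (rule mult_left_mono)
    finally show ?thesis by simp
  qed
  have C: "\<bar>\<Sum>i<K. peano_phi c * (LINT z|lborel. n i z * g z) -
      integral {real i / 9 ^ m..(real i + 1) / 9 ^ m} (\<lambda>s. g (peano_x s))\<bar> \<le> 2 * \<omega> + 9 * G * (3 ^ m * c)\<^sup>2"
  proof -
    let ?B = "2 * \<omega> + 9 * G * (3 ^ m * c)\<^sup>2"
    have B0: "0 \<le> ?B" using \<omega>[of 0 0] G0 by simp
    have "\<bar>\<Sum>i<K. peano_phi c * (LINT z|lborel. n i z * g z) -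
      integral {real i / 9 ^ m..(real i + 1) / 9 ^ m} (\<lambda>s. g (peano_x s))\<bar> \<le> (\<Sum>i<K. ?B / 9 ^ m)"
      unfolding n_def using i
      by (intro order_trans[OF sum_abs] sum_mono cell_estimate c g G \<omega>) auto
    also have "\<dots> = (real K / 9 ^ m) * ?B" by simp
    also have "\<dots> \<le> 1 * ?B"
      using B0 order_trans[OF l(2,3)] unfolding l_def by (intro mult_right_mono)
    finally show ?thesis by simp
  qed
  have "peano_phi c * (LINT z|lborel. N z * g z) - integral {0..t} (\<lambda>s. g (peano_x s)) =
    (\<Sum>i<K. peano_phi c * (LINT z|lborel. n i z * g z) -
      integral {real i / 9 ^ m..(real i + 1) / 9 ^ m} (\<lambda>s. g (peano_x s))) +
    peano_phi c * (LINT z|lborel. r z * g z) + peano_phi c * (LINT z|lborel. e z * g z) -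
    integral {l..t} (\<lambda>s. g (peano_x s))"
    unfolding e_eq I by (simp add: sum_subtractf sum_distrib_left distrib_left)
  thus ?thesis using C R E T unfolding N_def[symmetric] by simp
qed

text \<open>The level \<open>m\<close> is fixed first to control the oscillation of \<open>g\<close>
  and the partial cell. Only then does \<open>c\<close> tend to 0, which removes the terms whose
  factors grow with \<open>m\<close>.\<close>

lemma tendsto_crossing_integral:
  assumes t: "t \<in> {0..1}" and g: "continuous_on UNIV g"
  shows "((\<lambda>c. LINT z|lborel. peano_phi c * real (crossings z c peano_x 0 t) * g z)
    \<longlongrightarrow> integral {0..t} (\<lambda>s. g (peano_x s))) (at_right 0)"
proof (rule tendstoI)
  fix \<epsilon> :: real assume \<epsilon>: "\<epsilon> > 0"
  have g01: "continuous_on {0..1} g" using g continuous_on_subset by blast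
  obtain G where G: "\<And>z. z \<in> {0..1} \<Longrightarrow> \<bar>g z\<bar> \<le> G"
    using continuous_on_unit_interval_bounded[OF g01] by blast
  have G0: "0 \<le> G" using G[of 0] by simp
  have "uniformly_continuous_on {0..1} g" using g01 by (intro compact_uniformly_continuous) auto
  then obtain \<delta> where \<delta>: "\<delta> > 0"
    "\<And>z z'. z \<in> {0..1} \<Longrightarrow> z' \<in> {0..1} \<Longrightarrow> dist z' z < \<delta> \<Longrightarrow> dist (g z') (g z) < \<epsilon> / 8"
    unfolding uniformly_continuous_on_def using \<epsilon> by (metis zero_less_divide_iff zero_less_numeral)
  \<comment> \<open>The first bound makes \<open>2 * \<omega>\<close> at most
    \<open>\<epsilon> / 4\<close>, the second does the same for \<open>2 * G / 9 ^ m\<close>; adding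
    1 to \<open>G\<close> avoids division by 0.\<close>
  define \<eta> where "\<eta> = min \<delta> (\<epsilon> / (8 * (G + 1)))"
  have "\<eta> > 0" using \<delta>(1) \<epsilon> G0 by (simp add: \<eta>_def)
  then obtain m where "(1/3) ^ m < \<eta>" using real_arch_pow_inv[of \<eta> "1/3"] by auto
  hence m: "1 / 3 ^ m < \<delta>" "1 / 3 ^ m < \<epsilon> / (8 * (G + 1))" by (simp_all add: \<eta>_def power_divide)
  have \<omega>: "\<bar>g z - g z'\<bar> \<le> \<epsilon> / 8" if "z \<in> {0..1}" "z' \<in> {0..1}" "\<bar>z - z'\<bar> \<le> 1 / 3 ^ m" for z z'
    using \<delta>(2)[OF that(2,1)] that(3) m(1) by (auto simp: dist_real_def)
  have Gm: "2 * G / 9 ^ m \<le> \<epsilon> / 4"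
  proof -
    have "1 / 9 ^ m \<le> 1 / (3::real) ^ m" by (intro divide_left_mono power_mono) auto
    hence "1 / 9 ^ m \<le> \<epsilon> / (8 * (G + 1))" using m(2) by linarith
    hence "2 * G * (1 / 9 ^ m) \<le> 2 * G * (\<epsilon> / (8 * (G + 1)))" using G0 by (intro mult_left_mono) auto
    also have "\<dots> \<le> \<epsilon> / 4" using G0 \<epsilon> by (simp add: field_simps)
    finally show ?thesis by simp
  qed
  have lim: "((\<lambda>c. 9 * G * (3 ^ m * c)\<^sup>2 + 24 * 9 ^ m * G * c) \<longlongrightarrow> 0) (at_right 0)"
    by (auto intro!: tendsto_eq_intros)
  have "\<forall>\<^sub>F c in at_right 0. 9 * G * (3 ^ m * c)\<^sup>2 + 24 * 9 ^ m * G * c < \<epsilon> / 4"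
    using order_tendstoD(2)[OF lim, of "\<epsilon> / 4"] \<epsilon> by simp
  moreover have "\<forall>\<^sub>F c in at_right (0::real). 0 < c \<and> c < 1 / 3 ^ m"
    unfolding eventually_at_right_field by (intro exI[of _ "1 / 3 ^ m"]) auto
  ultimately show "\<forall>\<^sub>F c in at_right 0. dist (LINT z|lborel. peano_phi c * real (crossings z c peano_x 0 t) * g z)
    (integral {0..t} (\<lambda>s. g (peano_x s))) < \<epsilon>"
  proof eventually_elim
    case (elim c)
    have "(LINT z|lborel. peano_phi c * real (crossings z c peano_x 0 t) * g z) =
        peano_phi c * (LINT z|lborel. real (crossings z c peano_x 0 t) * g z)"
      by (simp add: mult.assoc)
    thus ?case
      using crossing_integral_estimate[OF t _ _ g G \<omega>, of c m] elim Gm \<epsilon>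
      by (simp add: dist_real_def)
  qed
qed

text \<open>A continuous \<open>g\<close> may be unbounded on the line and is then no admissible
  test function. It is cut off outside [0,1], where \<open>L t\<close> vanishes almost
  everywhere.\<close>

lemma local_time_integral:
  assumes L: "is_local_time peano_x L" and t: "t \<in> {0..1}" and g: "continuous_on UNIV g"
  shows "integrable lborel (\<lambda>z. L t z * g z)"
    and "(LINT z|lborel. L t z * g z) = integral {0..t} (\<lambda>s. g (peano_x s))"
proof -
  have Lt: "\<And>z. 0 \<le> L t z" "L t \<in> borel_measurable borel"
    "\<And>h. h \<in> borel_measurable borel \<Longrightarrow> bounded (range h) \<Longrightarrow>
      set_integrable lborel {0..t} (\<lambda>s. h (peano_x s)) \<and> integrable lborel (\<lambda>z. h z * L t z) \<and>
      (LINT s:{0..t}|lborel. h (peano_x s)) = (LINT z|lborel. h z * L t z)"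
    using L t unfolding is_local_time_def by blast+
  have x01: "peano_x s \<in> {0..1}" if "s \<in> {0..t}" for s
    using that t by (intro peano_x_bounds) auto
  have gm: "g \<in> borel_measurable borel" using g by (rule borel_measurable_continuous_onI)
  have g01: "continuous_on {0..1} g" using g continuous_on_subset by blast
  obtain G where G: "\<And>z. z \<in> {0..1} \<Longrightarrow> \<bar>g z\<bar> \<le> G"
    using continuous_on_unit_interval_bounded[OF g01] by blast
  have G0: "0 \<le> G" using G[of 0] by simp

  \<comment> \<open>Testing with the indicator of the complement of [0,1], which the curve never
    visits, shows that \<open>L t\<close> has no mass there.\<close>
  let ?out = "indicator (- {0..1}) :: real \<Rightarrow> real"
  have out: "integrable lborel (\<lambda>z. ?out z * L t z)"
    "(LINT s:{0..t}|lborel. ?out (peano_x s)) = (LINT z|lborel. ?out z * L t z)"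
  proof -
    have "bounded (range ?out)"
      unfolding bounded_iff by (intro exI[of _ 1]) (auto simp: indicator_def)
    from Lt(3)[OF _ this] show "integrable lborel (\<lambda>z. ?out z * L t z)"
      "(LINT s:{0..t}|lborel. ?out (peano_x s)) = (LINT z|lborel. ?out z * L t z)" by auto
  qed
  have "(LINT s:{0..t}|lborel. ?out (peano_x s)) = (LINT s:{0..t}|lborel. 0)"
    using x01 by (intro set_lebesgue_integral_cong) auto
  hence "(LINT z|lborel. ?out z * L t z) = 0" using out(2) by simp
  hence ae: "AE z in lborel. ?out z * L t z = 0"
    using out(1) Lt(1) by (subst (asm) integral_nonneg_eq_0_iff_AE) auto

  \<comment> \<open>The cut-off is bounded and Borel, and it agrees with \<open>g\<close> on all
    values of the curve.\<close>
  define h where "h z = g z * indicator {0..1} z" for z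
  have h: "h \<in> borel_measurable borel" unfolding h_def using gm by measurable
  have "bounded (range h)"
    using G G0 by (auto simp: bounded_iff h_def indicator_def intro!: exI[of _ G])
  note Lh = Lt(3)[OF h this]
  have ae': "AE z in lborel. h z * L t z = L t z * g z"
    using ae by eventually_elim (auto simp: h_def indicator_def split: if_splits)
  have m: "(\<lambda>z. L t z * g z) \<in> borel_measurable lborel" using Lt(2) gm by simp
  have hL: "integrable lborel (\<lambda>z. h z * L t z)" using Lh by blast
  show "integrable lborel (\<lambda>z. L t z * g z)"
    by (rule integrable_cong_AE_imp[OF hL m ae'])
  have "(LINT z|lborel. L t z * g z) = (LINT z|lborel. h z * L t z)"
    by (rule integral_cong_AE[OF borel_measurable_integrable[OF hL] m ae', symmetric])
  also have "\<dots> = (LINT s:{0..t}|lborel. h (peano_x s))" using Lh by simp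
  also have "\<dots> = integral {0..t} (\<lambda>s. h (peano_x s))"
    using Lh by (intro set_borel_integral_eq_integral(2)) blast
  also have "\<dots> = integral {0..t} (\<lambda>s. g (peano_x s))"
    using x01 by (intro Henstock_Kurzweil_Integration.integral_cong) (auto simp: h_def)
  finally show "(LINT z|lborel. L t z * g z) = integral {0..t} (\<lambda>s. g (peano_x s))" .
qed

lemma weighted_crossings_integrable:
  assumes "t \<in> {0..1}" "continuous_on UNIV g" "c > 0"
  shows "integrable lborel (\<lambda>z. peano_phi c * real (crossings z c peano_x 0 t) * g z)"
proof -
  have gm: "g \<in> borel_measurable borel" using assms(2) by (rule borel_measurable_continuous_onI)
  have g01: "continuous_on {0..1} g" using assms(2) continuous_on_subset by blast
  obtain G where G: "\<And>z. z \<in> {0..1} \<Longrightarrow> \<bar>g z\<bar> \<le> G"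
    using continuous_on_unit_interval_bounded[OF g01] by blast
  have "integrable lborel (\<lambda>z. peano_phi c * (real (crossings z c peano_x 0 t) * g z))"
    using crossings_peano_x_integrable[OF assms(3) _ _ _ gm G, of 0 t] assms(1)
    by (intro integrable_mult_right) auto
  thus ?thesis by (simp add: mult.assoc)
qed

theorem mainTheorem3:
  fixes L :: "real \<Rightarrow> real \<Rightarrow> real"
  assumes "is_local_time peano_x L"
  shows "(peano_phi \<longlongrightarrow> 0) (at_right 0) \<and>
    (\<forall>t\<in>{0..1}. \<forall>g::real \<Rightarrow> real. continuous_on UNIV g \<longrightarrow>
       (\<forall>c\<in>{0<..<1}. integrable lborel (\<lambda>z. peano_phi c * real (crossings z c peano_x 0 t) * g z)) \<and>
       integrable lborel (\<lambda>z. L t z * g z) \<and>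
       ((\<lambda>c. LINT z|lborel. peano_phi c * real (crossings z c peano_x 0 t) * g z)
          \<longlongrightarrow> (LINT z|lborel. L t z * g z)) (at_right 0))"
  using tendsto_peano_phi weighted_crossings_integrable tendsto_crossing_integral
    local_time_integral[OF assms] by simp

end
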